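(* Let $\mathbf E=(E_n)_{n\in\mathbb N}$ be a sequence of finite sets with $|E_n|\to\infty$. Let $\mathbf A=(A_n)$ and $\mathbf B=(B_n)$ be independent sequences of random subsets of $\mathbf E$, both belonging to $\mathcal D(\mathbf E)$ (densable and permutation invariant), with densities $\alpha$ and $\beta$ respectively. If $\alpha+\beta\neq 1$, then the sequence $\mathbf A\cap\mathbf B=(A_n\cap B_n)$ is also in $\mathcal D(\mathbf E)$, and $$\operatorname{dens}(\mathbf A\cap\mathbf B)=\begin{cases}\alpha+\beta-1 & \text{if }\alpha+\beta>1,\\ -\infty & \text{if }\alpha+\beta<1.\end{cases}$$
   Context: For a finite set $E$ (with $|E|\ge 2$) and $a\subseteq E$, the density of $a$ in $E$ is $\operatorname{dens}_E(a)=\log_{|E|}|a|\in\{-\infty\}\cup[0,1]$, with $\log 0=-\infty$. A random subset of $E$ is a random variable with values in the power set $\mathcal P(E)$. A sequence of random subsets of $\mathbf E=(E_n)$ is a sequence $(A_n)$ where $A_n$ is a random subset of $E_n$ for each $n$. Such a sequence is densable with density $d\in\{-\infty\}\cup[0,1]$ if the random variables $\operatorname{dens}_{E_n}(A_n)=\log_{|E_n|}|A_n|$ (with values in $\{-\infty\}\cup[0,1]$) converge in distribution to the constant $d$; one then writes $\operatorname{dens}\mathbf A=d$. In particular the density is $-\infty$ if and only if $\Pr(A_n=\emptyset)\to 1$. A random subset $A$ of $E$ is permutation invariant if $\Pr(A=a)=\Pr(A=\sigma(a))$ for every $a\subseteq E$ and every permutation $\sigma$ of $E$. $\mathcal D(\mathbf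 E)$ denotes the class of densable sequences $(A_n)$ of random subsets of $\mathbf E$ with each $A_n$ permutation invariant in $E_n$. Two sequences $(A_n),(B_n)$ are independent if $A_n$ and $B_n$ are independent for every $n$. By convention $-\infty+x=-\infty<1$. *)

theory Defs
  imports "HOL-Probability.Probability" "HOL-Combinatorics.Permutations"
begin

text \<open>Sequences of random subsets: \<open>E n\<close> is the ambient set, \<open>M n\<close> the probability space on which
  the random subset \<open>A n\<close> of \<open>E n\<close> is defined. The spaces may vary with \<open>n\<close>.\<close>

text \<open>For \<open>card E \<le> 1\<close>, where the logarithm to base \<open>card E\<close> makes no sense, the value is
  \<open>-\<infinity>\<close> or \<open>0\<close>, so \<open>dens E a\<close> always lies in \<open>dens_range\<close> below.\<close>

definition dens :: "'a set \<Rightarrow> 'a set \<Rightarrow> ereal" where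
  "dens E a = (if card a = 0 then -\<infinity> else ereal (log (real (card E)) (real (card a))))"

definition dens_range :: "ereal set" where
  "dens_range = insert (-\<infinity>) {0..1}"

definition random_subset :: "'w measure \<Rightarrow> 'a set \<Rightarrow> ('w \<Rightarrow> 'a set) \<Rightarrow> bool" where
  "random_subset M E A \<longleftrightarrow> prob_space M \<and> A \<in> measurable M (count_space (Pow E))"

definition permutation_invariant :: "'w measure \<Rightarrow> 'a set \<Rightarrow> ('w \<Rightarrow> 'a set) \<Rightarrow> bool" where
  "permutation_invariant M E A \<longleftrightarrow>
     (\<forall>a \<sigma>. a \<subseteq> E \<longrightarrow> \<sigma> permutes E \<longrightarrow>
        measure M {\<omega> \<in> space M. A \<omega> = a} = measure M {\<omega> \<in> space M. A \<omega> = \<sigma> ` a})"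

text \<open>Weak convergence of measures on the subspace \<open>S\<close> of a topological space. The library's
  \<open>weak_conv_m\<close> covers only measures on the real line, but densities may be \<open>-\<infinity>\<close>.\<close>

definition weak_conv_on ::
    "'b::topological_space set \<Rightarrow> (nat \<Rightarrow> 'b measure) \<Rightarrow> 'b measure \<Rightarrow> bool" where
  "weak_conv_on S \<mu> \<nu> \<longleftrightarrow>
     (\<forall>f :: 'b \<Rightarrow> real. continuous_on S f \<longrightarrow> bounded (f ` S) \<longrightarrow>
        (\<lambda>n. \<integral>x. f x \<partial>\<mu> n) \<longlonglongrightarrow> (\<integral>x. f x \<partial>\<nu>))"

definition converges_in_distribution_to_const ::
    "'b::topological_space set \<Rightarrow> (nat \<Rightarrow> 'w measure) \<Rightarrow> (nat \<Rightarrow> 'w \<Rightarrow> 'b) \<Rightarrow> 'b \<Rightarrow> bool" where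
  "converges_in_distribution_to_const S M X d \<longleftrightarrow>
     weak_conv_on S (\<lambda>n. distr (M n) (restrict_space borel S) (X n))
       (return (restrict_space borel S) d)"

definition densable_with_density ::
    "(nat \<Rightarrow> 'w measure) \<Rightarrow> (nat \<Rightarrow> 'a set) \<Rightarrow> (nat \<Rightarrow> 'w \<Rightarrow> 'a set) \<Rightarrow> ereal \<Rightarrow> bool" where
  "densable_with_density M E A d \<longleftrightarrow>
     (\<forall>n. random_subset (M n) (E n) (A n)) \<and> d \<in> dens_range \<and>
     converges_in_distribution_to_const dens_range M (\<lambda>n \<omega>. dens (E n) (A n \<omega>)) d"

text \<open>Membership in the class \<open>\<D>(E)\<close>.\<close>

definition densable_invariant ::
    "(nat \<Rightarrow> 'w measure) \<Rightarrow> (nat \<Rightarrow> 'a set) \<Rightarrow> (nat \<Rightarrow> 'w \<Rightarrow> 'a set) \<Rightarrow> bool" where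
  "densable_invariant M E A \<longleftrightarrow>
     (\<exists>d. densable_with_density M E A d) \<and>
     (\<forall>n. permutation_invariant (M n) (E n) (A n))"

definition independent_sequences ::
    "(nat \<Rightarrow> 'w measure) \<Rightarrow> (nat \<Rightarrow> 'a set) \<Rightarrow> (nat \<Rightarrow> 'w \<Rightarrow> 'a set) \<Rightarrow> (nat \<Rightarrow> 'w \<Rightarrow> 'a set) \<Rightarrow> bool"
  where
  "independent_sequences M E A B \<longleftrightarrow>
     (\<forall>n. prob_space.indep_var (M n)
        (count_space (Pow (E n))) (A n) (count_space (Pow (E n))) (B n))"

lemma dens_in_dens_range:
  assumes "finite E" "a \<subseteq> E"
  shows "dens E a \<in> dens_range"
proof (cases "card a = 0")
  case True
  then show ?thesis by (simp add: dens_def dens_range_def)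
next
  case False
  have le: "card a \<le> card E" using assms by (rule card_mono)
  have "0 \<le> log (real (card E)) (real (card a)) \<and> log (real (card E)) (real (card a)) \<le> 1"
  proof (cases "card E = 1")
    case True
    then show ?thesis by (simp add: log_def)
  next
    case c: False
    with False le have "1 < real (card E)" by linarith
    with False le show ?thesis by simp
  qed
  with False show ?thesis by (simp add: dens_def dens_range_def)
qed

lemma densable_with_density_unique:
  assumes "densable_with_density M E A d" "densable_with_density M E A d'"
  shows "d = d'"
proof -
  define f :: "ereal \<Rightarrow> real" where "f x = real_of_ereal (max (-1) x)" for x
  have cont: "continuous_on dens_range f"
  proof -
    have fin: "\<bar>max (-1) x\<bar> \<noteq> \<infinity>" if "x \<in> dens_range" for x
      using that by (cases x) (auto simp: dens_range_def max_def)
    have "continuous_on ((\<lambda>x. max (-1) x) ` dens_range) real_of_ereal"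
      using fin by (intro continuous_at_imp_continuous_on) (auto simp: continuous_at_of_ereal)
    moreover have "continuous_on dens_range (\<lambda>x::ereal. max (-1) x)"
      by (intro continuous_intros)
    ultimately show ?thesis unfolding f_def by (rule continuous_on_compose2) auto
  qed
  have bdd: "bounded (f ` dens_range)"
    unfolding bounded_iff
  proof (intro exI[of _ 1] ballI)
    fix y assume "y \<in> f ` dens_range"
    then obtain x where x: "x \<in> dens_range" "y = f x" by auto
    then show "norm y \<le> 1"
      by (cases x) (auto simp: dens_range_def f_def max_def)
  qed
  have lim: "(\<lambda>n. \<integral>x. f x \<partial>distr (M n) (restrict_space borel dens_range)
       (\<lambda>\<omega>. dens (E n) (A n \<omega>))) \<longlonglongrightarrow> f e"
    if "densable_with_density M E A e" for e
  proof -
    have "e \<in> dens_range" using that by (simp add: densable_with_density_def)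
    then have eq: "(\<integral>x. f x \<partial>return (restrict_space borel dens_range) e) = f e"
      by (intro integral_return borel_measurable_continuous_on_restrict cont)
         (simp add: space_restrict_space)
    have "weak_conv_on dens_range (\<lambda>n. distr (M n) (restrict_space borel dens_range)
        (\<lambda>\<omega>. dens (E n) (A n \<omega>))) (return (restrict_space borel dens_range) e)"
      using that by (simp only: densable_with_density_def converges_in_distribution_to_const_def)
    from this[unfolded weak_conv_on_def, rule_format, OF cont bdd] show ?thesis
      by (simp only: eq)
  qed
  have "f d = f d'" using lim[OF assms(1)] lim[OF assms(2)] by (rule LIMSEQ_unique)
  have vals: "e = -\<infinity> \<and> f e = -1 \<or> 0 \<le> f e \<and> e = ereal (f e)" if "e \<in> dens_range" for e
    using that by (cases e) (auto simp: dens_range_def f_def max_def one_ereal_def)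
  have "d \<in> dens_range" "d' \<in> dens_range"
    using assms by (auto simp: densable_with_density_def)
  note vals[OF this(1)] vals[OF this(2)]
  with \<open>f d = f d'\<close> show ?thesis
    by (elim disjE conjE) auto
qed

end

theory Submission
  imports Defs
begin

text \<open>For every fixed \<open>a\<close>, permutation invariance makes \<open>B\<close> uniform among the subsets of its
  cardinality \<open>l\<close>, so that the size of \<open>a \<inter> B\<close> is hypergeometric with mean \<open>\<mu> = card a * l / N\<close>
  and variance at most \<open>\<mu>\<close>, where \<open>N = card E\<close>. With high probability \<open>card A\<close> and \<open>card B\<close> are
  \<open>N powr (\<alpha> + o(1))\<close> and \<open>N powr (\<beta> + o(1))\<close>, whence \<open>\<mu> = N powr (\<alpha> + \<beta> - 1 + o(1))\<close>. If the
  exponent is negative, Markov's inequality shows that the intersection is empty with high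
  probability; if it is positive, Chebyshev's inequality gives a size between \<open>\<mu> / 2\<close> and
  \<open>3 * \<mu> / 2\<close>.\<close>

section \<open>Counting subsets of fixed size\<close>

text \<open>The sizes of both sets are random and, with high probability, known only up to factors
  \<open>N powr e\<close>, so no single hypergeometric law governs the intersection. The estimates
  are therefore uniform over every fixed \<open>a\<close> and every layer of sets \<open>b\<close>
  of size \<open>l\<close>; bounds on the sizes are made part of the event, so that layers outside
  them contribute nothing.

  The variance bound rests on negative correlation: a uniform \<open>l\<close>-subset contains two
  given distinct points with probability at most \<open>(l / N)^2\<close>, the value for independent
  points. The second moment thus exceeds \<mu>^2 by at most the diagonal contribution \<mu>.

  Constant factors such as 1/2 and 3/2 disappear in a factor \<open>N powr e\<close>, because
  densities see only exponents. At \<alpha> + \<beta> = 1 the mean is merely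
  \<open>N powr o(1)\<close>; it may tend to 0, stay bounded or diverge, so neither inequality
  decides.

  Since -\<infinity> is a possible density, convergence is expressed by tail events that compare
  cardinalities with real powers of \<open>N\<close>; in these the empty set is no
  exception.\<close>

lemma card_subsets_containing:
  assumes E: "finite E" and T: "T \<subseteq> E" "card T \<le> l"
  shows "card {b. b \<subseteq> E \<and> card b = l \<and> T \<subseteq> b} = (card E - card T) choose (l - card T)"
proof -
  have fT: "finite T" using T(1) E by (rule finite_subset)
  \<comment> \<open>Removing \<open>T\<close> leaves an arbitrary subset of \<open>E - T\<close>.
    For \<open>l < card T\<close> the truncated difference would turn the binomial coefficient into
    1, although no such set exists.\<close>
  have "bij_betw (\<lambda>c. c \<union> T) {c. c \<subseteq> E - T \<and> card c = l - card T}
      {b. b \<subseteq> E \<and> card b = l \<and> T \<subseteq> b}"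
  proof (rule bij_betw_byWitness[where f' = "\<lambda>b. b - T"])
    show "(\<lambda>c. c \<union> T) ` {c. c \<subseteq> E - T \<and> card c = l - card T}
        \<subseteq> {b. b \<subseteq> E \<and> card b = l \<and> T \<subseteq> b}"
    proof safe
      fix c assume c: "c \<subseteq> E - T" "card c = l - card T"
      have "finite c" using c(1) E by (meson finite_Diff finite_subset)
      then have "card (c \<union> T) = card c + card T"
        using fT c(1) by (intro card_Un_disjoint) auto
      then show "card (c \<union> T) = l" using c T by simp
    qed (use T in auto)
    show "(\<lambda>b. b - T) ` {b. b \<subseteq> E \<and> card b = l \<and> T \<subseteq> b}
        \<subseteq> {c. c \<subseteq> E - T \<and> card c = l - card T}"
      using fT by (auto simp: card_Diff_subset)
  qed auto
  then have "card {b. b \<subseteq> E \<and> card b = l \<and> T \<subseteq> b}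
      = card {c. c \<subseteq> E - T \<and> card c = l - card T}"
    by (rule bij_betw_same_card[symmetric])
  also have "\<dots> = (card E - card T) choose (l - card T)"
    using E T(1) fT by (simp add: n_subsets card_Diff_subset)
  finally show ?thesis .
qed

text \<open>Read as a probability, this is \<open>l / N\<close>; multiplying out keeps the double
  counting in the natural numbers and covers \<open>l = 0\<close> and \<open>l > N\<close>
  too.\<close>

lemma card_subsets_containing_one:
  assumes E: "finite E" and x: "x \<in> E"
  shows "card E * card {b. b \<subseteq> E \<and> card b = l \<and> x \<in> b} = l * (card E choose l)"
proof (cases "l = 0")
  case True
  have "{b. b \<subseteq> E \<and> card b = l \<and> x \<in> b} = {}"
    using E True by (auto dest: finite_subset simp: card_eq_0_iff)
  then show ?thesis using True by (simp only: card.empty)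
next
  case False
  have "card {b. b \<subseteq> E \<and> card b = l \<and> x \<in> b} = (card E - 1) choose (l - 1)"
    using card_subsets_containing[of E "{x}" l] E x False by simp
  moreover have "0 < card E" using E x by (auto simp: card_gt_0_iff)
  ultimately show ?thesis
    using False times_binomial_minus1_eq[of l "card E"] by simp
qed

text \<open>Negative correlation of two memberships: given the first point, the second one belongs
  to the set with probability \<open>(l - 1) / (N - 1)\<close>, and this is at most
  \<open>l / N\<close> exactly because \<open>l \<le> N\<close>.\<close>

lemma card_subsets_containing_two:
  assumes E: "finite E" and xy: "x \<in> E" "y \<in> E" "x \<noteq> y"
  shows "(card E)\<^sup>2 * card {b. b \<subseteq> E \<and> card b = l \<and> x \<in> b \<and> y \<in> b} \<le> l\<^sup>2 * (card E choose l)"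
\<comment> \<open>For \<open>l < 2\<close> truncated subtraction would spoil the binomials, and for
  \<open>l > N\<close> the comparison of the two ratios fails; in both ranges there is nothing to
  count.\<close>
proof (cases "2 \<le> l \<and> l \<le> card E")
  case False
  have "{b. b \<subseteq> E \<and> card b = l \<and> x \<in> b \<and> y \<in> b} = {}"
  proof safe
    fix b assume b: "b \<subseteq> E" "l = card b" "x \<in> b" "y \<in> b"
    have "card {x, y} \<le> card b"
      using b E by (intro card_mono) (auto dest: finite_subset)
    moreover have "card b \<le> card E" using b E by (intro card_mono) auto
    ultimately show "b \<in> {}" using False b xy by auto
  qed
  then show ?thesis by (simp only: card.empty)
next
  case True
  define N where "N = card E"
  define D1 where "D1 = (N - 1) choose (l - 1)"
  define D2 where "D2 = (N - 2) choose (l - 2)"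
  have "card {b. b \<subseteq> E \<and> card b = l \<and> x \<in> b \<and> y \<in> b} = D2"
    using card_subsets_containing[of E "{x, y}" l] E xy True by (simp add: D2_def N_def numeral_2_eq_2)
  moreover have "N * D1 = l * (N choose l)"
    using times_binomial_minus1_eq[of l N] True by (simp add: D1_def)
  moreover have "N * D2 \<le> l * D1"
  proof -
    have *: "(N - 1) * D2 = (l - 1) * D1"
      using times_binomial_minus1_eq[of "l - 1" "N - 1"] True
      by (simp add: D1_def D2_def numeral_2_eq_2)
    have "(N - 1) * (N * D2) = N * (l - 1) * D1"
      using * by (simp add: ac_simps)
    also have "\<dots> \<le> ((N - 1) * l) * D1"
      using True by (intro mult_right_mono) (auto simp: algebra_simps diff_mult_distrib N_def)
    finally show ?thesis using True by (simp add: N_def ac_simps)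
  qed
  ultimately show ?thesis
    unfolding N_def[symmetric] power2_eq_square
    by (metis mult.assoc mult.left_commute mult_le_mono2)
qed

lemma finite_subsets_of_card [simp]: "finite E \<Longrightarrow> finite {b. b \<subseteq> E \<and> card b = l}"
  by (rule finite_subset[of _ "Pow E"]) auto

lemma card_Int_eq_sum: "finite a \<Longrightarrow> card (a \<inter> b) = (\<Sum>x\<in>a. if x \<in> b then 1 else 0)"
  by (simp add: sum.If_cases Int_def)

section \<open>Moments of the intersection with a uniform subset of fixed size\<close>

lemma sum_card_Int:
  assumes E: "finite E" and a: "a \<subseteq> E"
  shows "card E * (\<Sum>b | b \<subseteq> E \<and> card b = l. card (a \<inter> b)) = card a * l * (card E choose l)"
proof -
  have fa: "finite a" using a E by (rule finite_subset)
  have "(\<Sum>b | b \<subseteq> E \<and> card b = l. card (a \<inter> b))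
      = (\<Sum>x\<in>a. \<Sum>b | b \<subseteq> E \<and> card b = l. if x \<in> b then 1 else 0)"
    by (simp only: card_Int_eq_sum[OF fa] sum.swap[of _ a])
  also have "\<dots> = (\<Sum>x\<in>a. card {b. b \<subseteq> E \<and> card b = l \<and> x \<in> b})"
    using E by (simp add: sum.If_cases Int_def conj_assoc)
  finally have "card E * (\<Sum>b | b \<subseteq> E \<and> card b = l. card (a \<inter> b))
      = (\<Sum>x\<in>a. card E * card {b. b \<subseteq> E \<and> card b = l \<and> x \<in> b})"
    by (simp add: sum_distrib_left)
  also have "\<dots> = (\<Sum>x\<in>a. l * (card E choose l))"
    using a by (intro sum.cong refl card_subsets_containing_one[OF E]) auto
  finally show ?thesis by simp
qed

text \<open>Expanding the square counts ordered pairs of points of \<open>a\<close> that both lie in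
  \<open>b\<close>. The diagonal reproduces the first moment, and negative correlation bounds the
  other pairs by the square of the mean.\<close>

lemma sum_card_Int_squared:
  assumes E: "finite E" and a: "a \<subseteq> E"
  shows "(card E)\<^sup>2 * (\<Sum>b | b \<subseteq> E \<and> card b = l. (card (a \<inter> b))\<^sup>2)
    \<le> (card E * card a * l + (card a * l)\<^sup>2) * (card E choose l)"
proof -
  define N where "N = card E"
  define C where "C = N choose l"
  define S where "S = {b. b \<subseteq> E \<and> card b = l}"
  define c where "c x y = card {b. b \<subseteq> E \<and> card b = l \<and> x \<in> b \<and> y \<in> b}" for x y
  have fa: "finite a" using a E by (rule finite_subset)
  have "(\<Sum>b\<in>S. (card (a \<inter> b))\<^sup>2)
      = (\<Sum>b\<in>S. \<Sum>x\<in>a. \<Sum>y\<in>a. if x \<in> b \<and> y \<in> b then 1 else 0)"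
    unfolding card_Int_eq_sum[OF fa] power2_eq_square sum_product
    by (intro sum.cong refl) auto
  also have "\<dots> = (\<Sum>x\<in>a. \<Sum>y\<in>a. \<Sum>b\<in>S. if x \<in> b \<and> y \<in> b then 1 else 0)"
    by (simp only: sum.swap[of _ a S])
  also have "\<dots> = (\<Sum>x\<in>a. \<Sum>y\<in>a. c x y)"
    using E by (simp add: S_def c_def sum.If_cases Int_def conj_assoc)
  finally have "N\<^sup>2 * (\<Sum>b\<in>S. (card (a \<inter> b))\<^sup>2) = (\<Sum>x\<in>a. \<Sum>y\<in>a. N\<^sup>2 * c x y)"
    by (simp add: sum_distrib_left)
  \<comment> \<open>On the diagonal the summand \<open>N * l * C\<close> alone would do; adding the
    off-diagonal bound there as well makes it constant over all pairs, so the double sum evaluates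
    at once.\<close>
  also have "\<dots> \<le> (\<Sum>x\<in>a. \<Sum>y\<in>a. (if y = x then N * l * C else 0) + l\<^sup>2 * C)"
  proof (intro sum_mono)
    fix x y assume xy: "x \<in> a" "y \<in> a"
    show "N\<^sup>2 * c x y \<le> (if y = x then N * l * C else 0) + l\<^sup>2 * C"
    proof (cases "y = x")
      case True
      have "N * c x x = l * C"
        using card_subsets_containing_one[OF E, of x l] xy a
        by (auto simp: c_def N_def C_def)
      then have "N\<^sup>2 * c x x = N * l * C" by (simp add: power2_eq_square mult.assoc)
      then show ?thesis using True by simp
    next
      case False
      then show ?thesis
        using card_subsets_containing_two[OF E, of x y l] xy a
        by (auto simp: c_def N_def C_def)
    qed
  qed
  also have "\<dots> = card a * (N * l * C) + card a * (card a * (l\<^sup>2 * C))"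
    using fa by (simp add: sum.distrib distrib_left)
  also have "\<dots> = (N * card a * l + (card a * l)\<^sup>2) * C"
    by (simp add: algebra_simps power2_eq_square)
  finally show ?thesis by (simp add: N_def C_def S_def)
qed

text \<open>Chebyshev's inequality for the hypergeometric distribution, whose variance is at most its
  mean \<open>card a * l / card E\<close>.\<close>

lemma card_Int_concentration:
  assumes E: "finite E" and a: "a \<subseteq> E" and pos: "0 < card a" "0 < l"
  defines "\<mu> \<equiv> real (card a) * real l"
  shows "real (card {b. b \<subseteq> E \<and> card b = l \<and> \<mu> / 2 < \<bar>real (card E) * real (card (a \<inter> b)) - \<mu>\<bar>})
    \<le> 4 * real (card E) / \<mu> * real (card E choose l)"
proof -
  \<comment> \<open>Everything is scaled by \<open>N\<close> to avoid divisions: here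
    \<open>\<mu>\<close> is \<open>N\<close> times the mean of \<open>X\<close>, and the deviation
    is that of \<open>N * X b\<close>.\<close>
  define N where "N = real (card E)"
  define C where "C = real (card E choose l)"
  define S where "S = {b. b \<subseteq> E \<and> card b = l}"
  define X where "X b = real (card (a \<inter> b))" for b
  define T where "T = {b. b \<subseteq> E \<and> card b = l \<and> \<mu> / 2 < \<bar>N * X b - \<mu>\<bar>}"
  have \<mu>: "0 < \<mu>" using pos by (simp add: \<mu>_def)
  have fS: "finite S" using E by (simp add: S_def)
  have "real (card E * (\<Sum>b\<in>S. card (a \<inter> b))) = real (card a * l * (card E choose l))"
    unfolding S_def sum_card_Int[OF E a] ..
  then have m1: "N * (\<Sum>b\<in>S. X b) = \<mu> * C"
    by (simp add: N_def X_def C_def \<mu>_def)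
  have "real ((card E)\<^sup>2 * (\<Sum>b\<in>S. (card (a \<inter> b))\<^sup>2))
      \<le> real ((card E * card a * l + (card a * l)\<^sup>2) * (card E choose l))"
    unfolding S_def of_nat_le_iff by (rule sum_card_Int_squared[OF E a])
  then have m2: "N\<^sup>2 * (\<Sum>b\<in>S. (X b)\<^sup>2) \<le> (N * \<mu> + \<mu>\<^sup>2) * C"
    by (simp add: N_def X_def C_def \<mu>_def mult.assoc)
  have cS: "real (card S) = C"
    using E by (simp add: S_def C_def n_subsets)
  have "real (card T) * (\<mu> / 2)\<^sup>2 = (\<Sum>b\<in>T. (\<mu> / 2)\<^sup>2)" by simp
  also have "\<dots> \<le> (\<Sum>b\<in>T. (N * X b - \<mu>)\<^sup>2)"
  proof (intro sum_mono)
    fix b assume "b \<in> T"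
    then have "\<bar>\<mu> / 2\<bar> \<le> \<bar>N * X b - \<mu>\<bar>" using \<mu> by (simp add: T_def)
    then show "(\<mu> / 2)\<^sup>2 \<le> (N * X b - \<mu>)\<^sup>2" by (simp only: abs_le_square_iff)
  qed
  also have "\<dots> \<le> (\<Sum>b\<in>S. (N * X b - \<mu>)\<^sup>2)"
    using fS by (intro sum_mono2) (auto simp: T_def S_def)
  also have "\<dots> = (\<Sum>b\<in>S. N\<^sup>2 * (X b)\<^sup>2 - 2 * \<mu> * (N * X b) + \<mu>\<^sup>2)"
    by (intro sum.cong refl) (simp add: power2_eq_square algebra_simps)
  also have "\<dots> = N\<^sup>2 * (\<Sum>b\<in>S. (X b)\<^sup>2) - 2 * \<mu> * (N * (\<Sum>b\<in>S. X b)) + \<mu>\<^sup>2 * C"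
    by (simp add: sum.distrib sum_subtractf sum_distrib_left cS mult.commute)
  \<comment> \<open>By the first moment the mixed term equals \<open>-2 * \<mu>\<^sup>2 * C\<close>,
    which cancels the two squares and leaves the scaled variance. Dividing by
    \<open>(\<mu> / 2)\<^sup>2\<close> then yields the factor 4.\<close>
  also have "\<dots> \<le> N * \<mu> * C"
    unfolding m1 using m2 by (simp add: algebra_simps power2_eq_square)
  finally have "real (card T) \<le> N * \<mu> * C / (\<mu> / 2)\<^sup>2"
    using \<mu> by (simp add: pos_le_divide_eq)
  also have "\<dots> = 4 * N / \<mu> * C"
    using \<mu> by (simp add: power2_eq_square field_simps)
  finally show ?thesis
    unfolding T_def N_def C_def X_def .
qed

section \<open>Independent random subsets\<close>

text \<open>The permutations of \<open>E\<close> act transitively on subsets of a given size: a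
  bijection from \<open>a\<close> to \<open>b\<close> and one between their complements glue
  together. This is the only way in which invariance turns into uniformity.\<close>

lemma permutation_invariant_card_cong:
  assumes E: "finite E" and inv: "permutation_invariant M E A"
    and ab: "a \<subseteq> E" "b \<subseteq> E" "card a = card b"
  shows "measure M {\<omega> \<in> space M. A \<omega> = a} = measure M {\<omega> \<in> space M. A \<omega> = b}"
proof -
  have fin: "finite a" "finite b" using ab E by (auto dest: finite_subset)
  obtain f where f: "bij_betw f a b"
    using finite_same_card_bij[OF fin ab(3)] by blast
  have "card (E - a) = card (E - b)"
    using fin ab by (simp add: card_Diff_subset)
  then obtain g where g: "bij_betw g (E - a) (E - b)"
    using finite_same_card_bij[of "E - a" "E - b"] E by blast
  define \<sigma> where "\<sigma> x = (if x \<in> a then f x else if x \<in> E then g x else x)" for x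
  have "bij_betw \<sigma> a b"
    using f by (rule bij_betw_cong[THEN iffD1, rotated]) (simp add: \<sigma>_def)
  moreover have "bij_betw \<sigma> (E - a) (E - b)"
    using g by (rule bij_betw_cong[THEN iffD1, rotated]) (simp add: \<sigma>_def)
  ultimately have "bij_betw \<sigma> (a \<union> (E - a)) (b \<union> (E - b))"
    by (rule bij_betw_combine) auto
  then have "bij_betw \<sigma> E E" using ab by (simp add: Un_absorb1 Un_Diff_cancel)
  then have "\<sigma> permutes E"
    using ab by (intro bij_imp_permutes) (auto simp: \<sigma>_def)
  moreover have "\<sigma> ` a = b" using \<open>bij_betw \<sigma> a b\<close> by (simp add: bij_betw_def)
  ultimately show ?thesis
    using inv ab(1) by (auto simp: permutation_invariant_def)
qed

text \<open>One index of the two sequences is frozen, so the bounds proved here are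
  non-asymptotic.\<close>

locale indep_random_subsets = prob_space M for M :: "'w measure" +
  fixes E :: "'a set" and A B :: "'w \<Rightarrow> 'a set"
  assumes fin: "finite E"
    and A: "A \<in> measurable M (count_space (Pow E))"
    and B: "B \<in> measurable M (count_space (Pow E))"
    and indep: "indep_var (count_space (Pow E)) A (count_space (Pow E)) B"
begin

lemma prob_pair:
  assumes "a \<subseteq> E" "b \<subseteq> E"
  shows "prob {\<omega> \<in> space M. A \<omega> = a \<and> B \<omega> = b}
    = prob {\<omega> \<in> space M. A \<omega> = a} * prob {\<omega> \<in> space M. B \<omega> = b}"
proof -
  have "prob ((\<lambda>\<omega>. (A \<omega>, B \<omega>)) -` ({a} \<times> {b}) \<inter> space M)
      = prob (A -` {a} \<inter> space M) * prob (B -` {b} \<inter> space M)"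
    using assms by (intro indep_varD[OF indep]) auto
  then show ?thesis by (simp add: vimage_def Int_def conj_commute)
qed

text \<open>As \<open>Pow E\<close> is finite, the product of the two discrete sigma-algebras is
  again discrete, so every relation between the two sets is an event.\<close>

lemma sets_pair: "{\<omega> \<in> space M. R (A \<omega>) (B \<omega>)} \<in> sets M"
proof -
  have "(\<lambda>\<omega>. (A \<omega>, B \<omega>)) \<in> measurable M (count_space (Pow E) \<Otimes>\<^sub>M count_space (Pow E))"
    using A B by (rule measurable_Pair)
  also have "count_space (Pow E) \<Otimes>\<^sub>M count_space (Pow E) = count_space (Pow E \<times> Pow E)"
    using fin by (intro pair_measure_countable) (auto intro: countable_finite)
  finally have "(\<lambda>\<omega>. (A \<omega>, B \<omega>)) -` ({(a, b). R a b} \<inter> Pow E \<times> Pow E) \<inter> space M \<in> sets M"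
    by (rule measurable_sets) auto
  also have "(\<lambda>\<omega>. (A \<omega>, B \<omega>)) -` ({(a, b). R a b} \<inter> Pow E \<times> Pow E) \<inter> space M
      = {\<omega> \<in> space M. R (A \<omega>) (B \<omega>)}"
    using measurable_space[OF A] measurable_space[OF B] by auto
  finally show ?thesis .
qed

text \<open>This takes the place of conditioning on \<open>A\<close>: the inner sum concerns
  \<open>B\<close> alone and can be bounded for each \<open>a\<close> separately.\<close>

lemma prob_eq_sum:
  "prob {\<omega> \<in> space M. R (A \<omega>) (B \<omega>)} = (\<Sum>a\<in>Pow E. \<Sum>b | b \<in> Pow E \<and> R a b.
     prob {\<omega> \<in> space M. A \<omega> = a} * prob {\<omega> \<in> space M. B \<omega> = b})"
proof -
  define I where "I = (SIGMA a:Pow E. {b. b \<in> Pow E \<and> R a b})"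
  define F where "F = (\<lambda>(a, b). {\<omega> \<in> space M. A \<omega> = a \<and> B \<omega> = b})"
  have fI: "finite I" using fin by (auto simp: I_def)
  have "prob {\<omega> \<in> space M. R (A \<omega>) (B \<omega>)} = prob (\<Union>i\<in>I. F i)"
    using measurable_space[OF A] measurable_space[OF B]
    by (intro arg_cong[of _ _ prob]) (auto simp: I_def F_def)
  also have "\<dots> = (\<Sum>i\<in>I. prob (F i))"
    using fI sets_pair
    by (intro finite_measure_finite_Union) (auto simp: F_def disjoint_family_on_def)
  also have "\<dots> = (\<Sum>(a, b)\<in>I. prob {\<omega> \<in> space M. A \<omega> = a} * prob {\<omega> \<in> space M. B \<omega> = b})"
    by (intro sum.cong refl) (auto simp: I_def F_def prob_pair)
  also have "\<dots> = (\<Sum>a\<in>Pow E. \<Sum>b | b \<in> Pow E \<and> R a b.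
      prob {\<omega> \<in> space M. A \<omega> = a} * prob {\<omega> \<in> space M. B \<omega> = b})"
    unfolding I_def using fin by (subst sum.Sigma) auto
  finally show ?thesis .
qed

lemma sum_prob_A: "(\<Sum>a\<in>Pow E. prob {\<omega> \<in> space M. A \<omega> = a}) = 1"
  and sum_prob_B: "(\<Sum>b\<in>Pow E. prob {\<omega> \<in> space M. B \<omega> = b}) = 1"
proof -
  have *: "(\<Sum>a\<in>Pow E. prob {\<omega> \<in> space M. X \<omega> = a}) = 1"
    if X: "X \<in> measurable M (count_space (Pow E))" for X
  proof -
    have s: "{\<omega> \<in> space M. X \<omega> = a} \<in> sets M" if "a \<subseteq> E" for a
      using measurable_sets[OF X, of "{a}"] that by (simp add: vimage_def Int_def conj_commute)
    have "(\<Sum>a\<in>Pow E. prob {\<omega> \<in> space M. X \<omega> = a}) = prob (\<Union>a\<in>Pow E. {\<omega> \<in> space M. X \<omega> = a})"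
      using fin s
      by (intro finite_measure_finite_Union[symmetric]) (auto simp: disjoint_family_on_def)
    also have "(\<Union>a\<in>Pow E. {\<omega> \<in> space M. X \<omega> = a}) = space M"
      using measurable_space[OF X] by auto
    finally show ?thesis by (simp add: prob_space)
  qed
  from *[OF A] *[OF B]
  show "(\<Sum>a\<in>Pow E. prob {\<omega> \<in> space M. A \<omega> = a}) = 1"
    and "(\<Sum>b\<in>Pow E. prob {\<omega> \<in> space M. B \<omega> = b}) = 1" .
qed

text \<open>Conditionally on \<open>A\<close> and on \<open>card B\<close>, an invariant \<open>B\<close> is uniformly distributed among the
  subsets of that cardinality, so probabilities reduce to counting.\<close>

lemma prob_le_by_counting:
  assumes inv: "permutation_invariant M E B"
    and count: "\<And>a l. a \<subseteq> E \<Longrightarrow> l \<le> card E \<Longrightarrow>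
      real (card {b. b \<subseteq> E \<and> card b = l \<and> R a b}) \<le> c * real (card E choose l)"
  shows "prob {\<omega> \<in> space M. R (A \<omega>) (B \<omega>)} \<le> c"
proof -
  define p where "p a = prob {\<omega> \<in> space M. A \<omega> = a}" for a
  define q where "q b = prob {\<omega> \<in> space M. B \<omega> = b}" for b
  have layers: "(\<Sum>b | b \<in> Pow E \<and> Q b. q b)
      = (\<Sum>l\<le>card E. \<Sum>b | b \<subseteq> E \<and> card b = l \<and> Q b. q b)" for Q
  proof -
    have "(\<Sum>b | b \<in> Pow E \<and> Q b. q b)
        = (\<Sum>l\<le>card E. \<Sum>b | b \<in> {b. b \<in> Pow E \<and> Q b} \<and> card b = l. q b)"
      using fin by (intro sum.group[symmetric]) (auto intro: card_mono)
    also have "\<dots> = (\<Sum>l\<le>card E. \<Sum>b | b \<subseteq> E \<and> card b = l \<and> Q b. q b)"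
      by (intro sum.cong refl) auto
    finally show ?thesis .
  qed
  \<comment> \<open>The vacuous conjunct \<open>True\<close> matches the instance of
    \<open>layers\<close> for the constant predicate, through which the total mass 1 of
    \<open>B\<close> is recovered below.\<close>
  have layer: "(\<Sum>b | b \<subseteq> E \<and> card b = l \<and> R a b. q b) \<le> c * (\<Sum>b | b \<subseteq> E \<and> card b = l \<and> True. q b)"
    if a: "a \<subseteq> E" and l: "l \<le> card E" for a l
  proof -
    obtain b0 where b0: "b0 \<subseteq> E" "card b0 = l"
      using l by (meson obtain_subset_with_card_n)
    have q: "q b = q b0" if "b \<subseteq> E" "card b = l" for b
      unfolding q_def using that b0 by (intro permutation_invariant_card_cong[OF fin inv]) auto
    have "(\<Sum>b | b \<subseteq> E \<and> card b = l \<and> R a b. q b)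
        = real (card {b. b \<subseteq> E \<and> card b = l \<and> R a b}) * q b0"
      using q by simp
    also have "\<dots> \<le> (c * real (card E choose l)) * q b0"
      using a l by (intro mult_right_mono count) (auto simp: q_def)
    also have "\<dots> = c * (\<Sum>b | b \<subseteq> E \<and> card b = l \<and> True. q b)"
      using q fin by (simp add: n_subsets)
    finally show ?thesis .
  qed
  have "prob {\<omega> \<in> space M. R (A \<omega>) (B \<omega>)} = (\<Sum>a\<in>Pow E. p a * (\<Sum>b | b \<in> Pow E \<and> R a b. q b))"
    by (simp add: prob_eq_sum p_def q_def sum_distrib_left)
  also have "\<dots> \<le> (\<Sum>a\<in>Pow E. p a * c)"
  proof (intro sum_mono mult_left_mono)
    fix a assume "a \<in> Pow E"
    then have "(\<Sum>b | b \<in> Pow E \<and> R a b. q b)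
        \<le> c * (\<Sum>l\<le>card E. \<Sum>b | b \<subseteq> E \<and> card b = l \<and> True. q b)"
      unfolding layers sum_distrib_left[of _ _ "{..card E}"] by (intro sum_mono layer) auto
    also have "(\<Sum>l\<le>card E. \<Sum>b | b \<subseteq> E \<and> card b = l \<and> True. q b) = 1"
      using sum_prob_B unfolding layers[symmetric] by (simp add: q_def Pow_def)
    finally show "(\<Sum>b | b \<in> Pow E \<and> R a b. q b) \<le> c" by simp
  qed (simp add: p_def)
  also have "\<dots> = c"
    using sum_prob_A by (simp add: p_def sum_distrib_right[symmetric])
  finally show ?thesis .
qed

section \<open>Markov and Chebyshev bounds for random sizes\<close>

lemma prob_Int_nonempty_le:
  assumes inv: "permutation_invariant M E B" and ne: "0 < card E" and s: "0 \<le> s" and t: "0 \<le> t"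
  shows "prob {\<omega> \<in> space M. real (card (A \<omega>)) \<le> s \<and> real (card (B \<omega>)) \<le> t \<and> A \<omega> \<inter> B \<omega> \<noteq> {}}
    \<le> s * t / real (card E)"
proof (rule prob_le_by_counting[OF inv,
      where R = "\<lambda>a b. real (card a) \<le> s \<and> real (card b) \<le> t \<and> a \<inter> b \<noteq> {}"])
  fix a l assume a: "a \<subseteq> E" and l: "l \<le> card E"
  define C where "C = real (card E choose l)"
  define T where "T = {b. b \<subseteq> E \<and> card b = l \<and> real (card a) \<le> s \<and> real (card b) \<le> t \<and> a \<inter> b \<noteq> {}}"
  have fa: "finite a" using a fin by (rule finite_subset)
  have "real (card T) \<le> s * t / real (card E) * C"
  \<comment> \<open>A layer that violates the size constraints is empty, so the bound needs to be
    checked only where the mean \<open>card a * l / N\<close> is at most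
    \<open>s * t / N\<close>.\<close>
  proof (cases "real (card a) \<le> s \<and> real l \<le> t")
    case False
    then have T: "T = {}" by (auto simp: T_def)
    show ?thesis using s t unfolding T by (simp add: C_def)
  next
    case True
    \<comment> \<open>Markov's inequality in counting form: each \<open>b\<close> in
      \<open>T\<close> contributes at least one point to the sum of the sizes of
      \<open>a \<inter> b\<close>.\<close>
    have "card T = (\<Sum>b\<in>T. 1)" by simp
    also have "\<dots> \<le> (\<Sum>b\<in>T. card (a \<inter> b))"
      using fa by (intro sum_mono) (auto simp: T_def Suc_le_eq card_gt_0_iff)
    also have "\<dots> \<le> (\<Sum>b | b \<subseteq> E \<and> card b = l. card (a \<inter> b))"
      using fin by (intro sum_mono2) (auto simp: T_def)
    finally have "card E * card T \<le> card a * l * (card E choose l)"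
      unfolding sum_card_Int[OF fin a, symmetric] by simp
    then have "real (card E) * real (card T) \<le> real (card a) * real l * C"
      unfolding C_def of_nat_mult[symmetric] of_nat_le_iff .
    also have "\<dots> \<le> s * t * C"
      using True s by (intro mult_right_mono mult_mono) (auto simp: C_def)
    finally show ?thesis using ne by (simp add: field_simps)
  qed
  then show "real (card {b. b \<subseteq> E \<and> card b = l \<and>
      real (card a) \<le> s \<and> real (card b) \<le> t \<and> a \<inter> b \<noteq> {}}) \<le> s * t / real (card E) * real (card E choose l)"
    by (simp add: T_def C_def)
qed

text \<open>The bound of \<open>card_Int_concentration\<close> decreases in both sizes, so the lower
  bounds \<open>s\<close> and \<open>t\<close> make it uniform; their positivity excludes empty
  sets, whose mean is 0.\<close>

lemma prob_Int_deviation_le: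
  assumes inv: "permutation_invariant M E B" and s: "0 < s" and t: "0 < t"
  shows "prob {\<omega> \<in> space M. s \<le> real (card (A \<omega>)) \<and> t \<le> real (card (B \<omega>)) \<and>
      real (card (A \<omega>)) * real (card (B \<omega>)) / 2
        < \<bar>real (card E) * real (card (A \<omega> \<inter> B \<omega>)) - real (card (A \<omega>)) * real (card (B \<omega>))\<bar>}
    \<le> 4 * real (card E) / (s * t)"
proof (rule prob_le_by_counting[OF inv, where R = "\<lambda>a b. s \<le> real (card a) \<and> t \<le> real (card b) \<and>
      real (card a) * real (card b) / 2
        < \<bar>real (card E) * real (card (a \<inter> b)) - real (card a) * real (card b)\<bar>"])
  fix a l assume a: "a \<subseteq> E" and l: "l \<le> card E"
  define \<mu> where "\<mu> = real (card a) * real l"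
  define T where "T = {b. b \<subseteq> E \<and> card b = l \<and> s \<le> real (card a) \<and> t \<le> real (card b) \<and>
      real (card a) * real (card b) / 2
        < \<bar>real (card E) * real (card (a \<inter> b)) - real (card a) * real (card b)\<bar>}"
  have "real (card T) \<le> 4 * real (card E) / (s * t) * real (card E choose l)"
  proof (cases "s \<le> real (card a) \<and> t \<le> real l")
    case False
    then have T: "T = {}" by (auto simp: T_def)
    show ?thesis using s t unfolding T by simp
  next
    case True
    then have pos: "0 < card a" "0 < l" using s t by auto
    have "T = {b. b \<subseteq> E \<and> card b = l \<and> \<mu> / 2 < \<bar>real (card E) * real (card (a \<inter> b)) - \<mu>\<bar>}"
      using True by (auto simp: T_def \<mu>_def)
    then have "real (card T) \<le> 4 * real (card E) / \<mu> * real (card E choose l)"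
      using card_Int_concentration[OF fin a pos] by (simp add: \<mu>_def)
    also have "\<dots> \<le> 4 * real (card E) / (s * t) * real (card E choose l)"
      using True s t unfolding \<mu>_def
      by (intro mult_right_mono divide_left_mono mult_mono mult_pos_pos) auto
    finally show ?thesis .
  qed
  then show "real (card {b. b \<subseteq> E \<and> card b = l \<and> s \<le> real (card a) \<and> t \<le> real (card b) \<and>
      real (card a) * real (card b) / 2
        < \<bar>real (card E) * real (card (a \<inter> b)) - real (card a) * real (card b)\<bar>})
    \<le> 4 * real (card E) / (s * t) * real (card E choose l)"
    by (simp add: T_def)
qed

lemma prob_Int_nonempty_le_tails:
  assumes inv: "permutation_invariant M E B" and ne: "0 < card E"
  defines "N \<equiv> real (card E)"
  shows "prob {\<omega> \<in> space M. A \<omega> \<inter> B \<omega> \<noteq> {}}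
    \<le> prob {\<omega> \<in> space M. N powr r < real (card (A \<omega>))}
      + prob {\<omega> \<in> space M. N powr s < real (card (B \<omega>))} + N powr (r + s - 1)"
proof -
  define U where "U = {\<omega> \<in> space M. N powr r < real (card (A \<omega>))}"
  define V where "V = {\<omega> \<in> space M. N powr s < real (card (B \<omega>))}"
  define W where "W = {\<omega> \<in> space M. real (card (A \<omega>)) \<le> N powr r \<and> real (card (B \<omega>)) \<le> N powr s
      \<and> A \<omega> \<inter> B \<omega> \<noteq> {}}"
  have sets: "U \<in> sets M" "V \<in> sets M" "W \<in> sets M"
    unfolding U_def V_def W_def by (rule sets_pair)+
  have N: "0 < N" using ne by (simp add: N_def)
  have "{\<omega> \<in> space M. A \<omega> \<inter> B \<omega> \<noteq> {}} \<subseteq> U \<union> V \<union> W"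
    unfolding U_def V_def W_def by (auto simp: not_less)
  then have "prob {\<omega> \<in> space M. A \<omega> \<inter> B \<omega> \<noteq> {}} \<le> prob (U \<union> V \<union> W)"
    using sets by (intro finite_measure_mono) auto
  also have "\<dots> \<le> prob U + prob V + prob W"
    using sets by (meson add_right_mono measure_Un_le order_trans sets.Un)
  also have "prob W \<le> N powr r * N powr s / N"
    unfolding W_def N_def by (rule prob_Int_nonempty_le[OF inv ne]) auto
  also have "N powr r * N powr s / N = N powr (r + s - 1)"
    using N by (simp add: powr_add powr_diff)
  finally show ?thesis by (simp add: U_def V_def)
qed

text \<open>Off the four tail events the product of the two sizes is \<open>N powr (x + y)\<close>
  up to a factor \<open>N powr (2 * e)\<close> either way. The Chebyshev factors 1/2 and 3/2 cost
  one more \<open>e\<close>, since \<open>N powr e\<close> is at least 2; hence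
  \<open>3 * e\<close>. The last summand is the Chebyshev bound at the lower thresholds.\<close>

lemma prob_card_Int_outside_le_tails:
  assumes inv: "permutation_invariant M E B" and ne: "0 < card E"
    and e: "real (card E) powr (-e) \<le> 1 / 2"
  defines "N \<equiv> real (card E)"
  shows "prob {\<omega> \<in> space M. N powr (x + y - 1 + 3 * e) < real (card (A \<omega> \<inter> B \<omega>)) \<or>
        real (card (A \<omega> \<inter> B \<omega>)) < N powr (x + y - 1 - 3 * e)}
    \<le> prob {\<omega> \<in> space M. N powr (x + e) < real (card (A \<omega>))}
      + prob {\<omega> \<in> space M. real (card (A \<omega>)) < N powr (x - e)}
      + prob {\<omega> \<in> space M. N powr (y + e) < real (card (B \<omega>))}
      + prob {\<omega> \<in> space M. real (card (B \<omega>)) < N powr (y - e)}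
      + 4 * N powr (- (x + y - 1 - 2 * e))"
proof -
  define T where "T = {\<omega> \<in> space M. N powr (x + y - 1 + 3 * e) < real (card (A \<omega> \<inter> B \<omega>)) \<or>
        real (card (A \<omega> \<inter> B \<omega>)) < N powr (x + y - 1 - 3 * e)}"
  define U1 where "U1 = {\<omega> \<in> space M. N powr (x + e) < real (card (A \<omega>))}"
  define U2 where "U2 = {\<omega> \<in> space M. real (card (A \<omega>)) < N powr (x - e)}"
  define V1 where "V1 = {\<omega> \<in> space M. N powr (y + e) < real (card (B \<omega>))}"
  define V2 where "V2 = {\<omega> \<in> space M. real (card (B \<omega>)) < N powr (y - e)}"
  define W where "W = {\<omega> \<in> space M. N powr (x - e) \<le> real (card (A \<omega>)) \<and>
      N powr (y - e) \<le> real (card (B \<omega>)) \<and> real (card (A \<omega>)) * real (card (B \<omega>)) / 2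
        < \<bar>real (card E) * real (card (A \<omega> \<inter> B \<omega>)) - real (card (A \<omega>)) * real (card (B \<omega>))\<bar>}"
  have sets: "U1 \<in> sets M" "U2 \<in> sets M" "V1 \<in> sets M" "V2 \<in> sets M" "W \<in> sets M"
    unfolding U1_def U2_def V1_def V2_def W_def by (rule sets_pair)+
  have N: "0 < N" using ne by (simp add: N_def)
  have "T \<subseteq> U1 \<union> U2 \<union> V1 \<union> V2 \<union> W"
  proof (rule subsetI, rule ccontr)
    fix \<omega> assume T: "\<omega> \<in> T" and notin: "\<omega> \<notin> U1 \<union> U2 \<union> V1 \<union> V2 \<union> W"
    define a where "a = real (card (A \<omega>))"
    define b where "b = real (card (B \<omega>))"
    define c where "c = real (card (A \<omega> \<inter> B \<omega>))"
    have a: "N powr (x - e) \<le> a" "a \<le> N powr (x + e)"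
      and b: "N powr (y - e) \<le> b" "b \<le> N powr (y + e)"
      and dev: "\<bar>N * c - a * b\<bar> \<le> a * b / 2"
      using T notin by (auto simp: T_def U1_def U2_def V1_def V2_def W_def a_def b_def c_def N_def)
    have half: "2 \<le> N powr e"
      using e N unfolding N_def[symmetric] by (simp add: powr_minus field_simps)
    have "N * c \<le> 3 / 2 * (a * b)" using dev by linarith
    also have "\<dots> \<le> N powr e * (N powr (x + e) * N powr (y + e))"
      using a b half by (intro mult_mono) (auto simp: a_def b_def)
    also have "\<dots> = N * N powr (x + y - 1 + 3 * e)"
      using N by (simp add: powr_add[symmetric] powr_mult_base algebra_simps)
    finally have "c \<le> N powr (x + y - 1 + 3 * e)" using N by simp
    moreover have "N powr (x + y - 1 - 3 * e) \<le> c"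
    proof -
      have "N * N powr (x + y - 1 - 3 * e) = N powr (-e) * (N powr (x - e) * N powr (y - e))"
        using N by (simp add: powr_add[symmetric] powr_mult_base algebra_simps)
      also have "\<dots> \<le> 1 / 2 * (a * b)"
        using a b e by (intro mult_mono) (auto simp: a_def b_def N_def)
      also have "\<dots> \<le> N * c" using dev by linarith
      finally show ?thesis using N by simp
    qed
    ultimately show False using T by (auto simp: T_def c_def)
  qed
  then have "prob T \<le> prob (U1 \<union> U2 \<union> V1 \<union> V2 \<union> W)"
    using sets by (intro finite_measure_mono) auto
  also have "\<dots> \<le> prob U1 + prob U2 + prob V1 + prob V2 + prob W"
    using sets by (meson add_right_mono measure_Un_le order_trans sets.Un)
  also have "prob W \<le> 4 * real (card E) / (N powr (x - e) * N powr (y - e))"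
    unfolding W_def using N by (intro prob_Int_deviation_le[OF inv]) auto
  also have "\<dots> = 4 * (N powr 1 / N powr ((x - e) + (y - e)))"
    using N unfolding powr_add by (simp add: N_def)
  also have "N powr 1 / N powr ((x - e) + (y - e)) = N powr (- (x + y - 1 - 2 * e))"
    unfolding powr_diff[symmetric] by (intro arg_cong2[of _ _ _ _ "(powr)"]) auto
  finally show ?thesis by (simp add: T_def U1_def U2_def V1_def V2_def)
qed

section \<open>The intersection as an invariant random subset\<close>

lemma random_subset_Int: "random_subset M E (\<lambda>\<omega>. A \<omega> \<inter> B \<omega>)"
proof -
  have "(\<lambda>\<omega>. A \<omega> \<inter> B \<omega>) \<in> measurable M (count_space (Pow E))"
  proof (subst measurable_count_space_eq2, use fin in simp, intro conjI ballI)
    show "(\<lambda>\<omega>. A \<omega> \<inter> B \<omega>) \<in> space M \<rightarrow> Pow E"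
      using measurable_space[OF A] by auto
    show "(\<lambda>\<omega>. A \<omega> \<inter> B \<omega>) -` {c} \<inter> space M \<in> sets M" for c
      using sets_pair[of "\<lambda>a b. a \<inter> b = c"] by (simp add: vimage_def Int_def conj_commute)
  qed
  then show ?thesis by (simp add: random_subset_def prob_space_axioms)
qed

text \<open>By independence the law of the pair is a product of invariant laws, hence invariant
  under applying \<open>\<sigma>\<close> to both sets at once, and the image under an injective map
  commutes with intersections.\<close>

lemma permutation_invariant_Int:
  assumes invA: "permutation_invariant M E A" and invB: "permutation_invariant M E B"
  shows "permutation_invariant M E (\<lambda>\<omega>. A \<omega> \<inter> B \<omega>)"
  unfolding permutation_invariant_def
proof (intro allI impI)
  fix c \<sigma> assume c: "c \<subseteq> E" and \<sigma>: "\<sigma> permutes E"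
  define p where "p a = prob {\<omega> \<in> space M. A \<omega> = a}" for a
  define q where "q b = prob {\<omega> \<in> space M. B \<omega> = b}" for b
  have inj: "inj \<sigma>" using \<sigma> by (rule permutes_inj)
  have bij: "bij_betw ((`) \<sigma>) (Pow E) (Pow E)"
    using \<sigma> by (intro bij_betw_Pow permutes_imp_bij)
  \<comment> \<open>Moving the condition from the index set into the summand leaves two sums over
    all of \<open>Pow E\<close>, which \<open>\<sigma>\<close> merely permutes.\<close>
  have sum: "prob {\<omega> \<in> space M. A \<omega> \<inter> B \<omega> = d}
      = (\<Sum>a\<in>Pow E. \<Sum>b\<in>Pow E. if a \<inter> b = d then p a * q b else 0)" for d
  proof -
    have "(\<Sum>b | b \<in> Pow E \<and> a \<inter> b = d. p a * q b)
        = (\<Sum>b\<in>Pow E. if a \<inter> b = d then p a * q b else 0)" for a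
      using fin by (subst sum.inter_filter[symmetric]) (auto intro: sum.cong)
    then show ?thesis
      using prob_eq_sum[of "\<lambda>a b. a \<inter> b = d"] by (simp add: p_def q_def)
  qed
  have "prob {\<omega> \<in> space M. A \<omega> \<inter> B \<omega> = \<sigma> ` c}
      = (\<Sum>a\<in>Pow E. \<Sum>b\<in>Pow E. if \<sigma> ` a \<inter> \<sigma> ` b = \<sigma> ` c then p (\<sigma> ` a) * q (\<sigma> ` b) else 0)"
    unfolding sum
    by (subst sum.reindex_bij_betw[OF bij, symmetric],
        rule sum.cong[OF refl], rule sum.reindex_bij_betw[OF bij, symmetric])
  also have "\<dots> = (\<Sum>a\<in>Pow E. \<Sum>b\<in>Pow E. if a \<inter> b = c then p a * q b else 0)"
  proof (intro sum.cong refl)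
    fix a b assume "a \<in> Pow E" "b \<in> Pow E"
    then have "p (\<sigma> ` a) = p a" "q (\<sigma> ` b) = q b"
      using invA invB \<sigma> by (auto simp: p_def q_def permutation_invariant_def)
    moreover have "\<sigma> ` a \<inter> \<sigma> ` b = \<sigma> ` c \<longleftrightarrow> a \<inter> b = c"
      using inj by (simp add: image_Int[symmetric] inj_image_eq_iff)
    ultimately show "(if \<sigma> ` a \<inter> \<sigma> ` b = \<sigma> ` c then p (\<sigma> ` a) * q (\<sigma> ` b) else 0)
        = (if a \<inter> b = c then p a * q b else 0)" by simp
  qed
  finally show "prob {\<omega> \<in> space M. A \<omega> \<inter> B \<omega> = c} = prob {\<omega> \<in> space M. A \<omega> \<inter> B \<omega> = \<sigma> ` c}"
    unfolding sum by simp
qed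

end

section \<open>Densities\<close>

text \<open>The coordinate \<open>x \<mapsto> max (-1) x\<close> identifies \<open>dens_range\<close> with \<open>{-1} \<union> {0..1}\<close>; it supplies
  the test functions for weak convergence.\<close>

definition dens_coord :: "ereal \<Rightarrow> real" where
  "dens_coord x = real_of_ereal (max (-1) x)"

lemma continuous_on_dens_coord: "continuous_on dens_range dens_coord"
proof -
  \<comment> \<open>\<open>real_of_ereal\<close> is continuous only at finite points; the cut-off at
    -1 keeps -\<infinity> away from it.\<close>
  have fin: "\<bar>max (-1) x\<bar> \<noteq> \<infinity>" if "x \<in> dens_range" for x
    using that by (cases x) (auto simp: dens_range_def max_def)
  have "continuous_on ((\<lambda>x. max (-1) x) ` dens_range) real_of_ereal"
    using fin by (intro continuous_at_imp_continuous_on) (auto simp: continuous_at_of_ereal)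
  moreover have "continuous_on dens_range (\<lambda>x::ereal. max (-1) x)"
    by (intro continuous_intros)
  ultimately show ?thesis unfolding dens_coord_def by (rule continuous_on_compose2) auto
qed

lemma dens_coord_cases:
  assumes "x \<in> dens_range"
  obtains "x = -\<infinity>" "dens_coord x = -1"
  | "0 \<le> dens_coord x" "dens_coord x \<le> 1" "x = ereal (dens_coord x)"
  using assms
  by (cases x) (auto simp: dens_range_def dens_coord_def max_def one_ereal_def zero_ereal_def)

lemma (in prob_space) expectation_tail_bound:
  fixes f :: "'b \<Rightarrow> real"
  assumes X: "X \<in> measurable M N" and f: "f \<in> borel_measurable N"
    and bdd: "\<And>x. x \<in> space N \<Longrightarrow> \<bar>f x\<bar> \<le> K"
    and nonneg: "\<And>x. x \<in> space N \<Longrightarrow> 0 \<le> f x"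
    and T: "T \<in> sets M" and T_ge: "\<And>\<omega>. \<omega> \<in> T \<Longrightarrow> \<delta> \<le> f (X \<omega>)"
  shows "\<delta> * prob T \<le> expectation (\<lambda>\<omega>. f (X \<omega>))"
proof -
  have sp: "X \<omega> \<in> space N" if "\<omega> \<in> space M" for \<omega>
    using X that by (rule measurable_space)
  have "integrable M (\<lambda>\<omega>. f (X \<omega>))"
    using bdd sp measurable_compose[OF X f] by (intro integrable_const_bound[where B = K]) auto
  moreover have "integrable M (\<lambda>\<omega>. \<delta> * indicator T \<omega>)"
    using T by (intro integrable_mult_right integrable_real_indicator) (auto simp: emeasure_eq_measure)
  ultimately have "expectation (\<lambda>\<omega>. \<delta> * indicator T \<omega>) \<le> expectation (\<lambda>\<omega>. f (X \<omega>))"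
    using nonneg sp T_ge by (intro integral_mono) (auto simp: indicator_def)
  then show ?thesis using T by simp
qed

text \<open>Off \<open>T\<close> the error is at most \<open>e\<close>; on \<open>T\<close>,
  boundedness of both terms limits it to \<open>2 * K\<close>.\<close>

lemma (in prob_space) expectation_dist_bound:
  fixes f :: "'b \<Rightarrow> real"
  assumes X: "X \<in> measurable M N" and f: "f \<in> borel_measurable N"
    and bdd: "\<And>x. x \<in> space N \<Longrightarrow> \<bar>f x\<bar> \<le> K" and c: "\<bar>c\<bar> \<le> K"
    and T: "T \<in> sets M" and e: "0 \<le> e"
    and near: "\<And>\<omega>. \<omega> \<in> space M \<Longrightarrow> \<omega> \<notin> T \<Longrightarrow> \<bar>f (X \<omega>) - c\<bar> \<le> e"
  shows "\<bar>expectation (\<lambda>\<omega>. f (X \<omega>)) - c\<bar> \<le> e + 2 * K * prob T"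
proof -
  have sp: "X \<omega> \<in> space N" if "\<omega> \<in> space M" for \<omega>
    using X that by (rule measurable_space)
  have int: "integrable M (\<lambda>\<omega>. f (X \<omega>))"
    using bdd sp measurable_compose[OF X f] by (intro integrable_const_bound[where B = K]) auto
  have int_T: "integrable M (\<lambda>\<omega>. 2 * K * indicator T \<omega>)"
    using T by (intro integrable_mult_right integrable_real_indicator) (auto simp: emeasure_eq_measure)
  have "expectation (\<lambda>\<omega>. f (X \<omega>)) - c = expectation (\<lambda>\<omega>. f (X \<omega>) - c)"
    using int by (simp add: prob_space)
  also have "\<bar>\<dots>\<bar> \<le> expectation (\<lambda>\<omega>. \<bar>f (X \<omega>) - c\<bar>)"
    by (rule integral_abs_bound)
  also have "\<dots> \<le> expectation (\<lambda>\<omega>. e + 2 * K * indicator T \<omega>)"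
  proof (intro integral_mono integrable_abs)
    fix \<omega> assume \<omega>: "\<omega> \<in> space M"
    show "\<bar>f (X \<omega>) - c\<bar> \<le> e + 2 * K * indicator T \<omega>"
      using near[OF \<omega>] bdd[OF sp[OF \<omega>]] c e by (auto simp: indicator_def)
  qed (use int int_T in auto)
  also have "\<dots> = e + 2 * K * prob T"
    using int_T T by (simp add: prob_space)
  finally show ?thesis .
qed

lemma dens_measurable:
  assumes "finite E" and "random_subset M E A"
  shows "(\<lambda>\<omega>. dens E (A \<omega>)) \<in> measurable M (restrict_space borel dens_range)"
proof -
  have "dens E \<in> measurable (count_space (Pow E)) (restrict_space borel dens_range)"
    using assms(1) dens_in_dens_range by (auto simp: space_restrict_space)
  with assms(2) show ?thesis
    by (auto simp: random_subset_def intro: measurable_compose)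
qed

text \<open>This equivalence and the next one remove the logarithm. They include the empty set,
  since -\<infinity> lies below every real \<open>r\<close> just as 0 lies below the power.\<close>

lemma less_dens_iff:
  assumes "2 \<le> card E"
  shows "ereal r < dens E a \<longleftrightarrow> real (card E) powr r < real (card a)"
proof (cases "card a = 0")
  case False
  then show ?thesis using assms by (simp add: dens_def less_log_iff)
qed (simp add: dens_def)

lemma dens_less_iff:
  assumes "2 \<le> card E"
  shows "dens E a < ereal r \<longleftrightarrow> real (card a) < real (card E) powr r"
proof (cases "card a = 0")
  case False
  then show ?thesis using assms by (simp add: dens_def log_less_iff)
qed (use assms in \<open>simp add: dens_def\<close>)

section \<open>Convergence to a constant density in terms of tails\<close>

lemma measure_tendsto_0_le:
  assumes "f \<longlonglongrightarrow> 0" and "\<forall>\<^sub>F n in sequentially. measure (M n) (S n) \<le> f n"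
  shows "(\<lambda>n. measure (M n) (S n)) \<longlonglongrightarrow> 0"
  by (rule tendsto_sandwich[OF _ assms(2) tendsto_const assms(1)]) simp

text \<open>Markov's inequality for a test function that vanishes at the limit \<open>d\<close> and
  is at least \<open>\<delta>\<close> on the tail: its expectation tends to \<open>f d\<close>, that
  is, to 0.\<close>

lemma dens_tail_tendsto:
  fixes X :: "nat \<Rightarrow> 'w \<Rightarrow> ereal"
    and f :: "ereal \<Rightarrow> real"
  assumes M: "\<And>n. prob_space (M n)"
    and X: "\<And>n. X n \<in> measurable (M n) (restrict_space borel dens_range)"
    and d: "d \<in> dens_range"
    and conv: "converges_in_distribution_to_const dens_range M X d"
    and cont: "continuous_on dens_range f" and bdd: "\<And>x. x \<in> dens_range \<Longrightarrow> \<bar>f x\<bar> \<le> K"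
    and nonneg: "\<And>x. x \<in> dens_range \<Longrightarrow> 0 \<le> f x" and f0: "f d = 0" and \<delta>: "0 < \<delta>"
    and far: "\<And>x. x \<in> dens_range \<Longrightarrow> Q x \<Longrightarrow> \<delta> \<le> f x"
    and Q: "\<And>n. {\<omega> \<in> space (M n). Q (X n \<omega>)} \<in> sets (M n)"
  shows "(\<lambda>n. measure (M n) {\<omega> \<in> space (M n). Q (X n \<omega>)}) \<longlonglongrightarrow> 0"
proof -
  have f: "f \<in> borel_measurable (restrict_space borel dens_range)"
    using cont by (rule borel_measurable_continuous_on_restrict)
  have "bounded (f ` dens_range)" using bdd by (auto simp: bounded_iff)
  with conv cont have "(\<lambda>n. \<integral>x. f x \<partial>distr (M n) (restrict_space borel dens_range) (X n))
      \<longlonglongrightarrow> (\<integral>x. f x \<partial>return (restrict_space borel dens_range) d)"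
    by (auto simp: converges_in_distribution_to_const_def weak_conv_on_def)
  also have "(\<integral>x. f x \<partial>return (restrict_space borel dens_range) d) = 0"
    using d f by (subst integral_return) (auto simp: space_restrict_space f0)
  finally have lim: "(\<lambda>n. (\<integral>\<omega>. f (X n \<omega>) \<partial>M n) / \<delta>) \<longlonglongrightarrow> 0"
    using integral_distr[OF X f] \<delta> by (auto intro!: tendsto_eq_intros)
  show ?thesis
  proof (rule measure_tendsto_0_le[OF lim])
    show "\<forall>\<^sub>F n in sequentially. measure (M n) {\<omega> \<in> space (M n). Q (X n \<omega>)} \<le> (\<integral>\<omega>. f (X n \<omega>) \<partial>M n) / \<delta>"
    proof (rule always_eventually, rule allI)
      fix n
      have "X n \<omega> \<in> dens_range" if "\<omega> \<in> space (M n)" for \<omega>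
        using measurable_space[OF X that] by (simp add: space_restrict_space)
      then have "\<delta> * measure (M n) {\<omega> \<in> space (M n). Q (X n \<omega>)} \<le> (\<integral>\<omega>. f (X n \<omega>) \<partial>M n)"
        by (intro prob_space.expectation_tail_bound[OF M X f, where K = K] bdd nonneg Q far)
          (auto simp: space_restrict_space)
      then show "measure (M n) {\<omega> \<in> space (M n). Q (X n \<omega>)} \<le> (\<integral>\<omega>. f (X n \<omega>) \<partial>M n) / \<delta>"
        using \<delta> by (simp add: field_simps)
    qed
  qed
qed

text \<open>A portmanteau theorem for a point mass. Real thresholds suffice even at -\<infinity>,
  which is isolated in \<open>dens_range\<close>; there the lower-tail condition is vacuous.\<close>

lemma converges_in_distribution_to_const_dens_iff:
  fixes X :: "nat \<Rightarrow> 'w \<Rightarrow> ereal"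
  assumes M: "\<And>n. prob_space (M n)"
    and X: "\<And>n. X n \<in> measurable (M n) (restrict_space borel dens_range)"
    and d: "d \<in> dens_range"
  shows "converges_in_distribution_to_const dens_range M X d \<longleftrightarrow>
    (\<forall>r. (d < ereal r \<longrightarrow> (\<lambda>n. measure (M n) {\<omega> \<in> space (M n). ereal r < X n \<omega>}) \<longlonglongrightarrow> 0) \<and>
         (ereal r < d \<longrightarrow> (\<lambda>n. measure (M n) {\<omega> \<in> space (M n). X n \<omega> < ereal r}) \<longlonglongrightarrow> 0))"
    (is "?conv \<longleftrightarrow> ?tails")
proof -
  have sp: "X n \<omega> \<in> dens_range" if "\<omega> \<in> space (M n)" for n \<omega>
    using measurable_space[OF X that] by (simp add: space_restrict_space)
  have X': "X n \<in> borel_measurable (M n)" for n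
    using X by (simp add: measurable_restrict_space2_iff)
  note [measurable] = X'
  show ?thesis
  proof
    assume conv: ?conv
    have coord_bounds: "-1 \<le> dens_coord x \<and> dens_coord x \<le> 1" if "x \<in> dens_range" for x
      using that by (cases rule: dens_coord_cases) auto
    show ?tails
    proof (intro allI conjI impI)
      fix r assume r: "d < ereal r"
      show "(\<lambda>n. measure (M n) {\<omega> \<in> space (M n). ereal r < X n \<omega>}) \<longlonglongrightarrow> 0"
      \<comment> \<open>Coordinates lie between -1 and 1, whence \<open>K = 2\<close>. If
        \<open>d\<close> is -\<infinity>, then \<open>r\<close> may be very negative, but points of
        \<open>dens_range\<close> above \<open>r\<close> have coordinate at least 0, one more than
        that of \<open>d\<close>.\<close>
      proof (rule dens_tail_tendsto[OF M X d conv, where K = 2 and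
            f = "\<lambda>x. max 0 (dens_coord x - dens_coord d)" and
            \<delta> = "if d = -\<infinity> then 1 else r - dens_coord d"])
        show "continuous_on dens_range (\<lambda>x. max 0 (dens_coord x - dens_coord d))"
          by (intro continuous_intros continuous_on_dens_coord)
        show "\<bar>max 0 (dens_coord x - dens_coord d)\<bar> \<le> 2" if "x \<in> dens_range" for x
          using coord_bounds[OF that] coord_bounds[OF d] by auto
        show "0 < (if d = -\<infinity> then 1 else r - dens_coord d)"
          using d r by (cases rule: dens_coord_cases) (auto, metis ereal_less(2) less_ereal.simps(1))
        show "(if d = -\<infinity> then 1 else r - dens_coord d) \<le> max 0 (dens_coord x - dens_coord d)"
          if "x \<in> dens_range" "ereal r < x" for x
          using that(1)
        proof (cases rule: dens_coord_cases)
          case 2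
          then have "r < dens_coord x" using that(2) by (metis less_ereal.simps(1))
          from d show ?thesis
            by (cases rule: dens_coord_cases) (use 2 \<open>r < dens_coord x\<close> in auto)
        qed (use that in auto)
      qed auto
    next
      fix r assume r: "ereal r < d"
      show "(\<lambda>n. measure (M n) {\<omega> \<in> space (M n). X n \<omega> < ereal r}) \<longlonglongrightarrow> 0"
      \<comment> \<open>No coordinate is below -1, so a smaller \<open>r\<close> is replaced by -1;
        then only the point -\<infinity> remains in the tail.\<close>
      proof (rule dens_tail_tendsto[OF M X d conv, where K = 2 and
            f = "\<lambda>x. max 0 (dens_coord d - dens_coord x)" and
            \<delta> = "dens_coord d - max (-1) r"])
        show "continuous_on dens_range (\<lambda>x. max 0 (dens_coord d - dens_coord x))"
          by (intro continuous_intros continuous_on_dens_coord)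
        show "\<bar>max 0 (dens_coord d - dens_coord x)\<bar> \<le> 2" if "x \<in> dens_range" for x
          using coord_bounds[OF that] coord_bounds[OF d] by auto
        show "0 < dens_coord d - max (-1) r"
          using d
        proof (cases rule: dens_coord_cases)
          case 2
          then have "r < dens_coord d" using r by (metis less_ereal.simps(1))
          with 2 show ?thesis by auto
        qed (use r in auto)
        show "dens_coord d - max (-1) r \<le> max 0 (dens_coord d - dens_coord x)"
          if "x \<in> dens_range" "x < ereal r" for x
          using that(1)
        proof (cases rule: dens_coord_cases)
          case 2
          then have "dens_coord x < r" using that(2) by (metis less_ereal.simps(1))
          then show ?thesis by auto
        qed auto
      qed auto
    qed
  next
    assume tails: ?tails
    have outside: "(\<lambda>n. measure (M n) {\<omega> \<in> space (M n). X n \<omega> \<notin> U}) \<longlonglongrightarrow> 0"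
      if U: "open U" "d \<in> U" for U
    proof (cases "d = -\<infinity>")
      case True
      \<comment> \<open>Any negative threshold would serve: it separates -\<infinity> from the
        remaining densities, which are nonnegative.\<close>
      then have "(\<lambda>n. measure (M n) {\<omega> \<in> space (M n). ereal (-1) < X n \<omega>}) \<longlonglongrightarrow> 0"
        using tails by auto
      moreover have "measure (M n) {\<omega> \<in> space (M n). X n \<omega> \<notin> U}
          \<le> measure (M n) {\<omega> \<in> space (M n). ereal (-1) < X n \<omega>}" for n
      proof (rule finite_measure.finite_measure_mono)
        show "{\<omega> \<in> space (M n). X n \<omega> \<notin> U} \<subseteq> {\<omega> \<in> space (M n). ereal (-1) < X n \<omega>}"
        proof safe
          fix \<omega> assume \<omega>: "\<omega> \<in> space (M n)" "X n \<omega> \<notin> U"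
          from sp[OF \<omega>(1)] show "ereal (-1) < X n \<omega>"
          proof (cases rule: dens_coord_cases)
            case 2
            then show ?thesis by (metis less_ereal.simps(1) less_le_trans neg_less_0_iff_less zero_less_one)
          qed (use \<omega> U True in auto)
        qed
      qed (use M in \<open>auto intro: prob_space.finite_measure\<close>)
      ultimately show ?thesis
        by (auto intro: measure_tendsto_0_le[OF _ always_eventually])
    next
      case False
      with d have fin: "\<bar>d\<bar> \<noteq> \<infinity>" by (auto simp: dens_range_def)
      obtain e where e: "0 < e" "{d - e <..< d + e} \<subseteq> U"
        using ereal_open_cont_interval[OF U fin] by blast
      \<comment> \<open>The radius \<open>e\<close> is an extended real and may be infinite. A
        strictly smaller real radius makes the closed interval left by the two strict tails fit
        inside the open one.\<close>
      obtain e' where e': "0 < e'" "ereal e' < e"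
        using ereal_dense2[OF e(1)] by (metis ereal_less(2))
      define x where "x = real_of_ereal d"
      have x: "d = ereal x" using fin by (simp add: x_def ereal_real)
      have "(\<lambda>n. measure (M n) {\<omega> \<in> space (M n). ereal (x + e') < X n \<omega>}
          + measure (M n) {\<omega> \<in> space (M n). X n \<omega> < ereal (x - e')}) \<longlonglongrightarrow> 0 + 0"
        using tails e' by (intro tendsto_add) (auto simp: x)
      moreover have "measure (M n) {\<omega> \<in> space (M n). X n \<omega> \<notin> U}
          \<le> measure (M n) {\<omega> \<in> space (M n). ereal (x + e') < X n \<omega>}
            + measure (M n) {\<omega> \<in> space (M n). X n \<omega> < ereal (x - e')}" for n
      proof -
        have "{\<omega> \<in> space (M n). X n \<omega> \<notin> U} \<subseteq> {\<omega> \<in> space (M n). ereal (x + e') < X n \<omega>}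
            \<union> {\<omega> \<in> space (M n). X n \<omega> < ereal (x - e')}"
        proof (rule subsetI, rule ccontr)
          fix \<omega> assume \<omega>: "\<omega> \<in> {\<omega> \<in> space (M n). X n \<omega> \<notin> U}"
            and "\<omega> \<notin> {\<omega> \<in> space (M n). ereal (x + e') < X n \<omega>}
              \<union> {\<omega> \<in> space (M n). X n \<omega> < ereal (x - e')}"
          then have "X n \<omega> \<le> ereal (x + e')" "ereal (x - e') \<le> X n \<omega>" by auto
          then have "X n \<omega> \<in> {d - e <..< d + e}"
            using e'(2) by (cases e; cases "X n \<omega>") (auto simp: x)
          with e(2) \<omega> show False by auto
        qed
        then have "measure (M n) {\<omega> \<in> space (M n). X n \<omega> \<notin> U}
            \<le> measure (M n) ({\<omega> \<in> space (M n). ereal (x + e') < X n \<omega>}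
              \<union> {\<omega> \<in> space (M n). X n \<omega> < ereal (x - e')})"
          using M by (intro finite_measure.finite_measure_mono) (auto intro: prob_space.finite_measure)
        also have "\<dots> \<le> measure (M n) {\<omega> \<in> space (M n). ereal (x + e') < X n \<omega>}
            + measure (M n) {\<omega> \<in> space (M n). X n \<omega> < ereal (x - e')}"
          by (intro measure_Un_le) auto
        finally show ?thesis .
      qed
      ultimately show ?thesis
        by (auto intro: measure_tendsto_0_le[OF _ always_eventually])
    qed
    show ?conv
      unfolding converges_in_distribution_to_const_def weak_conv_on_def
    proof (intro allI impI)
      fix f :: "ereal \<Rightarrow> real"
      assume cont: "continuous_on dens_range f" and bdd: "bounded (f ` dens_range)"
      have f: "f \<in> borel_measurable (restrict_space borel dens_range)"
        using cont by (rule borel_measurable_continuous_on_restrict)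
      obtain K where K: "0 < K" "\<And>x. x \<in> dens_range \<Longrightarrow> \<bar>f x\<bar> \<le> K"
        using bdd by (auto simp: bounded_pos)
      have "(\<lambda>n. \<integral>\<omega>. f (X n \<omega>) \<partial>M n) \<longlonglongrightarrow> f d"
      proof (rule LIMSEQ_I)
        fix e :: real assume e: "0 < e"
        \<comment> \<open>Continuity holds only on the subspace, so the preimage of the ball is the
          trace of an open set \<open>U\<close> of extended reals, to which \<open>outside\<close>
          applies.\<close>
        obtain U where U: "open U" "U \<inter> dens_range = f -` ball (f d) (e / 2) \<inter> dens_range"
          using cont[unfolded continuous_on_open_invariant, rule_format, OF open_ball] by blast
        have "d \<in> U" using U(2) d e by auto
        define P where "P n = measure (M n) {\<omega> \<in> space (M n). X n \<omega> \<notin> U}" for n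
        have "(\<lambda>n. e / 2 + 2 * K * P n) \<longlonglongrightarrow> e / 2 + 2 * K * 0"
          unfolding P_def by (intro tendsto_intros outside U \<open>d \<in> U\<close>)
        then have "\<forall>\<^sub>F n in sequentially. e / 2 + 2 * K * P n < e"
          by (rule order_tendstoD(2)) (use e in simp)
        then obtain n0 where n0: "\<And>n. n0 \<le> n \<Longrightarrow> e / 2 + 2 * K * P n < e"
          by (auto simp: eventually_sequentially)
        have "\<bar>(\<integral>\<omega>. f (X n \<omega>) \<partial>M n) - f d\<bar> \<le> e / 2 + 2 * K * P n" for n
          unfolding P_def
        proof (rule prob_space.expectation_dist_bound[OF M X f])
          have [measurable]: "U \<in> sets borel" using U(1) by simp
          show "{\<omega> \<in> space (M n). X n \<omega> \<notin> U} \<in> sets (M n)" by measurable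
          show "\<bar>f (X n \<omega>) - f d\<bar> \<le> e / 2"
            if "\<omega> \<in> space (M n)" "\<omega> \<notin> {\<omega> \<in> space (M n). X n \<omega> \<notin> U}" for \<omega>
          proof -
            have "X n \<omega> \<in> U \<inter> dens_range" using that sp by auto
            then show ?thesis unfolding U(2) by (auto simp: dist_real_def abs_minus_commute)
          qed
        qed (use K d e in \<open>auto simp: space_restrict_space\<close>)
        then show "\<exists>n0. \<forall>n\<ge>n0. norm ((\<integral>\<omega>. f (X n \<omega>) \<partial>M n) - f d) < e"
          using n0 by (auto intro!: exI[of _ n0] intro: le_less_trans)
      qed
      also have "(\<lambda>n. \<integral>\<omega>. f (X n \<omega>) \<partial>M n)
          = (\<lambda>n. \<integral>x. f x \<partial>distr (M n) (restrict_space borel dens_range) (X n))"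
        using integral_distr[OF X f] by simp
      also have "f d = (\<integral>x. f x \<partial>return (restrict_space borel dens_range) d)"
        using d f by (subst integral_return) (auto simp: space_restrict_space)
      finally show "(\<lambda>n. \<integral>x. f x \<partial>distr (M n) (restrict_space borel dens_range) (X n))
          \<longlonglongrightarrow> (\<integral>x. f x \<partial>return (restrict_space borel dens_range) d)" .
    qed
  qed
qed

text \<open>The working form of densability, used for both hypotheses and for the conclusion. The
  logarithm needs a base of at least 2, which holds eventually, and limits ask for no more.\<close>

lemma densable_with_density_iff:
  assumes fin: "\<And>n. finite (E n)" and large: "filterlim (\<lambda>n. card (E n)) at_top sequentially"
  shows "densable_with_density M E A d \<longleftrightarrow>
    (\<forall>n. random_subset (M n) (E n) (A n)) \<and> d \<in> dens_range \<and>
    (\<forall>r. (d < ereal r \<longrightarrow> (\<lambda>n. measure (M n)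
            {\<omega> \<in> space (M n). real (card (E n)) powr r < real (card (A n \<omega>))}) \<longlonglongrightarrow> 0) \<and>
         (ereal r < d \<longrightarrow> (\<lambda>n. measure (M n)
            {\<omega> \<in> space (M n). real (card (A n \<omega>)) < real (card (E n)) powr r}) \<longlonglongrightarrow> 0))"
proof (cases "(\<forall>n. random_subset (M n) (E n) (A n)) \<and> d \<in> dens_range")
  case True
  then have rs: "\<And>n. random_subset (M n) (E n) (A n)" and d: "d \<in> dens_range" by auto
  have ev: "\<forall>\<^sub>F n in sequentially. 2 \<le> card (E n)"
    using large by (simp add: filterlim_at_top)
  have "converges_in_distribution_to_const dens_range M (\<lambda>n \<omega>. dens (E n) (A n \<omega>)) d \<longleftrightarrow>
    (\<forall>r. (d < ereal r \<longrightarrow> (\<lambda>n. measure (M n)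
            {\<omega> \<in> space (M n). ereal r < dens (E n) (A n \<omega>)}) \<longlonglongrightarrow> 0) \<and>
         (ereal r < d \<longrightarrow> (\<lambda>n. measure (M n)
            {\<omega> \<in> space (M n). dens (E n) (A n \<omega>) < ereal r}) \<longlonglongrightarrow> 0))"
    using rs fin d
    by (intro converges_in_distribution_to_const_dens_iff dens_measurable)
      (auto simp: random_subset_def)
  moreover have "(\<lambda>n. measure (M n) {\<omega> \<in> space (M n). ereal r < dens (E n) (A n \<omega>)}) \<longlonglongrightarrow> 0
      \<longleftrightarrow> (\<lambda>n. measure (M n) {\<omega> \<in> space (M n). real (card (E n)) powr r < real (card (A n \<omega>))}) \<longlonglongrightarrow> 0" for r
    by (intro filterlim_cong refl eventually_mono[OF ev]) (simp add: less_dens_iff)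
  moreover have "(\<lambda>n. measure (M n) {\<omega> \<in> space (M n). dens (E n) (A n \<omega>) < ereal r}) \<longlonglongrightarrow> 0
      \<longleftrightarrow> (\<lambda>n. measure (M n) {\<omega> \<in> space (M n). real (card (A n \<omega>)) < real (card (E n)) powr r}) \<longlonglongrightarrow> 0" for r
    by (intro filterlim_cong refl eventually_mono[OF ev]) (simp add: dens_less_iff)
  ultimately show ?thesis using True by (simp add: densable_with_density_def)
qed (auto simp: densable_with_density_def)

section \<open>The density of the intersection\<close>

lemma densable_with_density_Int:
  fixes \<alpha> \<beta> :: ereal
  assumes fin: "\<And>n. finite (E n)" and large: "filterlim (\<lambda>n. card (E n)) at_top sequentially"
    and A: "densable_with_density M E A \<alpha>" and B: "densable_with_density M E B \<beta>"
    and inv: "\<And>n. permutation_invariant (M n) (E n) (B n)"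
    and irs: "\<And>n. indep_random_subsets (M n) (E n) (A n) (B n)"
    and ne: "\<alpha> + \<beta> \<noteq> 1"
  shows "densable_with_density M E (\<lambda>n \<omega>. A n \<omega> \<inter> B n \<omega>)
    (if \<alpha> + \<beta> > 1 then \<alpha> + \<beta> - 1 else -\<infinity>)"
proof -
  define N where "N n = real (card (E n))" for n
  define pA where "pA Q = (\<lambda>n. measure (M n) {\<omega> \<in> space (M n). Q n (real (card (A n \<omega>)))})"
    for Q :: "nat \<Rightarrow> real \<Rightarrow> bool"
  define pB where "pB Q = (\<lambda>n. measure (M n) {\<omega> \<in> space (M n). Q n (real (card (B n \<omega>)))})"
    for Q :: "nat \<Rightarrow> real \<Rightarrow> bool"
  note iff = densable_with_density_iff[where E = E, OF fin large, folded N_def]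
  have N: "filterlim N at_top sequentially"
    unfolding N_def by (rule filterlim_compose[OF filterlim_real_sequentially large])
  have N_powr: "(\<lambda>n. N n powr r) \<longlonglongrightarrow> 0" if "r < 0" for r
    by (rule tendsto_neg_powr[OF that N])
  have ev: "\<forall>\<^sub>F n in sequentially. 0 < card (E n)"
    using large by (simp add: filterlim_at_top Suc_le_eq[symmetric])
  have range: "\<alpha> \<in> dens_range" "\<beta> \<in> dens_range"
    using A B by (auto simp: densable_with_density_def)
  have A_up: "pA (\<lambda>n k. N n powr r < k) \<longlonglongrightarrow> 0" if "\<alpha> < ereal r" for r
    using A that unfolding iff pA_def by blast
  have A_low: "pA (\<lambda>n k. k < N n powr r) \<longlonglongrightarrow> 0" if "ereal r < \<alpha>" for r
    using A that unfolding iff pA_def by blast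
  have B_up: "pB (\<lambda>n k. N n powr r < k) \<longlonglongrightarrow> 0" if "\<beta> < ereal r" for r
    using B that unfolding iff pB_def by blast
  have B_low: "pB (\<lambda>n k. k < N n powr r) \<longlonglongrightarrow> 0" if "ereal r < \<beta>" for r
    using B that unfolding iff pB_def by blast
  have rs: "\<forall>n. random_subset (M n) (E n) (\<lambda>\<omega>. A n \<omega> \<inter> B n \<omega>)"
    by (intro allI indep_random_subsets.random_subset_Int irs)
  have fm: "finite_measure (M n)" for n
    using irs[of n] by (simp add: indep_random_subsets_def prob_space.finite_measure)
  show ?thesis
  proof (cases "\<alpha> + \<beta> > 1")
    case True
    obtain x where x: "\<alpha> = ereal x" "x \<le> 1"
      using True range by (cases \<alpha>; cases \<beta>) (auto simp: dens_range_def one_ereal_def)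
    obtain y where y: "\<beta> = ereal y" "y \<le> 1"
      using True range by (cases \<alpha>; cases \<beta>) (auto simp: dens_range_def one_ereal_def)
    define \<gamma> where "\<gamma> = x + y - 1"
    have \<gamma>: "0 < \<gamma>" "\<gamma> \<le> 1" using True x y by (auto simp: \<gamma>_def one_ereal_def)
    have dens: "(if \<alpha> + \<beta> > 1 then \<alpha> + \<beta> - 1 else -\<infinity>) = ereal \<gamma>"
      using True by (simp add: x y \<gamma>_def one_ereal_def)
    \<comment> \<open>Positivity of \<open>\<gamma>\<close> leaves room for such an
      \<open>e\<close>: with \<open>2 * e < \<gamma>\<close> the Chebyshev error
      \<open>4 * N n powr (- (\<gamma> - 2 * e))\<close> vanishes.\<close>
    have outside: "(\<lambda>n. measure (M n) {\<omega> \<in> space (M n).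
        N n powr (\<gamma> + 3 * e) < real (card (A n \<omega> \<inter> B n \<omega>)) \<or>
        real (card (A n \<omega> \<inter> B n \<omega>)) < N n powr (\<gamma> - 3 * e)}) \<longlonglongrightarrow> 0"
      if e: "0 < e" "2 * e < \<gamma>" for e
    proof (rule measure_tendsto_0_le[rotated])
      have "\<forall>\<^sub>F n in sequentially. N n powr (-e) < 1 / 2"
        using N_powr[of "-e"] e by (intro order_tendstoD(2)) auto
      then show "\<forall>\<^sub>F n in sequentially. measure (M n) {\<omega> \<in> space (M n).
          N n powr (\<gamma> + 3 * e) < real (card (A n \<omega> \<inter> B n \<omega>)) \<or>
          real (card (A n \<omega> \<inter> B n \<omega>)) < N n powr (\<gamma> - 3 * e)}
        \<le> pA (\<lambda>n k. N n powr (x + e) < k) n + pA (\<lambda>n k. k < N n powr (x - e)) n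
          + pB (\<lambda>n k. N n powr (y + e) < k) n + pB (\<lambda>n k. k < N n powr (y - e)) n
          + 4 * N n powr (- (\<gamma> - 2 * e))"
        using ev
      proof eventually_elim
        case (elim n)
        then show ?case
          unfolding pA_def pB_def N_def \<gamma>_def
          by (intro indep_random_subsets.prob_card_Int_outside_le_tails irs inv) auto
      qed
      have "(\<lambda>n. pA (\<lambda>n k. N n powr (x + e) < k) n + pA (\<lambda>n k. k < N n powr (x - e)) n
          + pB (\<lambda>n k. N n powr (y + e) < k) n + pB (\<lambda>n k. k < N n powr (y - e)) n
          + 4 * N n powr (- (\<gamma> - 2 * e))) \<longlonglongrightarrow> 0 + 0 + 0 + 0 + 4 * 0"
        using e by (intro tendsto_add tendsto_mult tendsto_const A_up A_low B_up B_low N_powr)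
          (auto simp: x y)
      then show "(\<lambda>n. pA (\<lambda>n k. N n powr (x + e) < k) n + pA (\<lambda>n k. k < N n powr (x - e)) n
          + pB (\<lambda>n k. N n powr (y + e) < k) n + pB (\<lambda>n k. k < N n powr (y - e)) n
          + 4 * N n powr (- (\<gamma> - 2 * e))) \<longlonglongrightarrow> 0" by simp
    qed
    have tail: "(\<lambda>n. measure (M n) {\<omega> \<in> space (M n). Q n (real (card (A n \<omega> \<inter> B n \<omega>)))}) \<longlonglongrightarrow> 0"
      if e: "0 < e" "2 * e < \<gamma>"
        and Q: "\<And>n k. 0 < card (E n) \<Longrightarrow> Q n k \<Longrightarrow> N n powr (\<gamma> + 3 * e) < k \<or> k < N n powr (\<gamma> - 3 * e)"
      for e and Q :: "nat \<Rightarrow> real \<Rightarrow> bool"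
    proof (rule measure_tendsto_0_le[OF outside[OF e]])
      show "\<forall>\<^sub>F n in sequentially.
          measure (M n) {\<omega> \<in> space (M n). Q n (real (card (A n \<omega> \<inter> B n \<omega>)))}
        \<le> measure (M n) {\<omega> \<in> space (M n).
            N n powr (\<gamma> + 3 * e) < real (card (A n \<omega> \<inter> B n \<omega>)) \<or>
            real (card (A n \<omega> \<inter> B n \<omega>)) < N n powr (\<gamma> - 3 * e)}"
        using ev
      proof eventually_elim
        case (elim n)
        show ?case
          by (rule finite_measure.finite_measure_mono[OF fm])
            (use Q[OF elim] in blast, rule indep_random_subsets.sets_pair[OF irs])
      qed
    qed
    have mono: "N n powr r \<le> N n powr s" if "0 < card (E n)" "r \<le> s" for n r s
      using that by (intro powr_mono) (auto simp: N_def)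
    show ?thesis
      unfolding iff dens
    proof (intro conjI allI impI rs[rule_format])
      show "ereal \<gamma> \<in> dens_range"
        using \<gamma> by (simp add: dens_range_def one_ereal_def zero_ereal_def)
    next
      fix r assume r: "ereal \<gamma> < ereal r"
      \<comment> \<open>A quarter of the minimum meets both demands, \<open>2 * e < \<gamma>\<close>
        and \<open>3 * e \<le> r - \<gamma>\<close>; the lower tail below uses the same
        choice.\<close>
      define e where "e = min \<gamma> (r - \<gamma>) / 4"
      have e_le: "\<gamma> + 3 * e \<le> r" using r by (auto simp: e_def min_def field_simps)
      show "(\<lambda>n. measure (M n) {\<omega> \<in> space (M n). N n powr r < real (card (A n \<omega> \<inter> B n \<omega>))}) \<longlonglongrightarrow> 0"
      proof (rule tail[of e])
        fix n k assume "0 < card (E n)" "N n powr r < k"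
        then show "N n powr (\<gamma> + 3 * e) < k \<or> k < N n powr (\<gamma> - 3 * e)"
          using mono[of n "\<gamma> + 3 * e" r] e_le by fastforce
      qed (use \<gamma> r in \<open>auto simp: e_def\<close>)
    next
      fix r assume r: "ereal r < ereal \<gamma>"
      define e where "e = min \<gamma> (\<gamma> - r) / 4"
      have e_le: "r \<le> \<gamma> - 3 * e" using r by (auto simp: e_def min_def field_simps)
      show "(\<lambda>n. measure (M n) {\<omega> \<in> space (M n). real (card (A n \<omega> \<inter> B n \<omega>)) < N n powr r}) \<longlonglongrightarrow> 0"
      proof (rule tail[of e])
        fix n k assume "0 < card (E n)" "k < N n powr r"
        then show "N n powr (\<gamma> + 3 * e) < k \<or> k < N n powr (\<gamma> - 3 * e)"
          using mono[of n r "\<gamma> - 3 * e"] e_le by fastforce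
      qed (use \<gamma> r in \<open>auto simp: e_def\<close>)
    qed
  next
    case False
    then have less: "\<alpha> + \<beta> < 1" using ne by auto
    obtain r s where rs': "\<alpha> < ereal r" "\<beta> < ereal s" "r + s < 1"
    proof (cases "\<alpha> = -\<infinity> \<or> \<beta> = -\<infinity>")
      \<comment> \<open>The other density is at most 1, so 2 exceeds it, and since every real
        exceeds -\<infinity>, the exponent -2 may be set against it.\<close>
      case True
      then show ?thesis
      proof
        assume "\<alpha> = -\<infinity>"
        moreover have "\<beta> < ereal 2" using range(2)
          by (cases \<beta>) (auto simp: dens_range_def one_ereal_def)
        ultimately show ?thesis by (intro that[of "-2" 2]) auto
      next
        assume "\<beta> = -\<infinity>"
        moreover have "\<alpha> < ereal 2" using range(1)
          by (cases \<alpha>) (auto simp: dens_range_def one_ereal_def)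
        ultimately show ?thesis by (intro that[of 2 "-2"]) auto
      qed
    next
      case False
      obtain x where x: "\<alpha> = ereal x"
        using False range(1) by (cases \<alpha>) (auto simp: dens_range_def)
      obtain y where y: "\<beta> = ereal y"
        using False range(2) by (cases \<beta>) (auto simp: dens_range_def)
      have "x + y < 1" using less by (simp add: x y one_ereal_def)
      \<comment> \<open>The slack \<open>1 - x - y\<close> is cut into thirds: one raises each
        exponent, the last keeps the sum strictly below 1.\<close>
      then show ?thesis
        by (intro that[of "x + (1 - x - y) / 3" "y + (1 - x - y) / 3"])
          (auto simp: x y field_simps)
    qed
    have nonempty: "(\<lambda>n. measure (M n) {\<omega> \<in> space (M n). A n \<omega> \<inter> B n \<omega> \<noteq> {}}) \<longlonglongrightarrow> 0"
    proof (rule measure_tendsto_0_le[rotated])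
      show "\<forall>\<^sub>F n in sequentially. measure (M n) {\<omega> \<in> space (M n). A n \<omega> \<inter> B n \<omega> \<noteq> {}}
        \<le> pA (\<lambda>n k. N n powr r < k) n + pB (\<lambda>n k. N n powr s < k) n + N n powr (r + s - 1)"
        using ev
      proof eventually_elim
        case (elim n)
        then show ?case
          unfolding pA_def pB_def N_def
          by (intro indep_random_subsets.prob_Int_nonempty_le_tails irs inv)
      qed
      have "(\<lambda>n. pA (\<lambda>n k. N n powr r < k) n + pB (\<lambda>n k. N n powr s < k) n + N n powr (r + s - 1))
          \<longlonglongrightarrow> 0 + 0 + 0"
        using rs' by (intro tendsto_add A_up B_up N_powr) auto
      then show "(\<lambda>n. pA (\<lambda>n k. N n powr r < k) n + pB (\<lambda>n k. N n powr s < k) n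
          + N n powr (r + s - 1)) \<longlonglongrightarrow> 0" by simp
    qed
    \<comment> \<open>Density -\<infinity> demands this for every real \<open>t\<close>, however
      negative. Powers are nonnegative, so a larger cardinality forces a point in the
      intersection.\<close>
    have "(\<lambda>n. measure (M n) {\<omega> \<in> space (M n). N n powr t < real (card (A n \<omega> \<inter> B n \<omega>))}) \<longlonglongrightarrow> 0"
      for t
    proof (rule measure_tendsto_0_le[OF nonempty])
      show "\<forall>\<^sub>F n in sequentially.
          measure (M n) {\<omega> \<in> space (M n). N n powr t < real (card (A n \<omega> \<inter> B n \<omega>))}
        \<le> measure (M n) {\<omega> \<in> space (M n). A n \<omega> \<inter> B n \<omega> \<noteq> {}}"
      proof (intro always_eventually allI finite_measure.finite_measure_mono fm)
        show "{\<omega> \<in> space (M n). N n powr t < real (card (A n \<omega> \<inter> B n \<omega>))}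
            \<subseteq> {\<omega> \<in> space (M n). A n \<omega> \<inter> B n \<omega> \<noteq> {}}" for n
          by (auto simp: not_less[symmetric])
        show "{\<omega> \<in> space (M n). A n \<omega> \<inter> B n \<omega> \<noteq> {}} \<in> sets (M n)" for n
          by (rule indep_random_subsets.sets_pair[OF irs])
      qed
    qed
    with False show ?thesis
      unfolding iff using rs by (auto simp: dens_range_def)
  qed
qed

theorem theorem1:
  fixes M :: "nat \<Rightarrow> 'w measure"
    and E :: "nat \<Rightarrow> 'a set"
    and A B :: "nat \<Rightarrow> 'w \<Rightarrow> 'a set"
    and \<alpha> \<beta> :: ereal
  assumes "\<And>n. finite (E n)"
    and "filterlim (\<lambda>n. card (E n)) at_top sequentially"
    and "densable_invariant M E A" and "densable_with_density M E A \<alpha>"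
    and "densable_invariant M E B" and "densable_with_density M E B \<beta>"
    and "independent_sequences M E A B"
    and "\<alpha> + \<beta> \<noteq> 1"
  shows "densable_invariant M E (\<lambda>n \<omega>. A n \<omega> \<inter> B n \<omega>) \<and>
         densable_with_density M E (\<lambda>n \<omega>. A n \<omega> \<inter> B n \<omega>)
           (if \<alpha> + \<beta> > 1 then \<alpha> + \<beta> - 1 else -\<infinity>)"
proof -
  have inv: "permutation_invariant (M n) (E n) (A n)" "permutation_invariant (M n) (E n) (B n)" for n
    using assms(3,5) by (auto simp: densable_invariant_def)
  have "random_subset (M n) (E n) (A n)" "random_subset (M n) (E n) (B n)" for n
    using assms(4,6) by (auto simp: densable_with_density_def)
  then have irs: "indep_random_subsets (M n) (E n) (A n) (B n)" for n
    using assms(1)[of n] assms(7)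
    by (auto simp: random_subset_def independent_sequences_def indep_random_subsets_def
        indep_random_subsets_axioms_def)
  have "densable_with_density M E (\<lambda>n \<omega>. A n \<omega> \<inter> B n \<omega>)
      (if \<alpha> + \<beta> > 1 then \<alpha> + \<beta> - 1 else -\<infinity>)"
    by (rule densable_with_density_Int[OF assms(1,2,4,6) inv(2) irs assms(8)])
  moreover have "permutation_invariant (M n) (E n) (\<lambda>\<omega>. A n \<omega> \<inter> B n \<omega>)" for n
    by (intro indep_random_subsets.permutation_invariant_Int irs inv)
  ultimately show ?thesis by (auto simp: densable_invariant_def)
qed

end
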